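(* If $\mathcal{Q}$ is a small quantaloid of closed cribles, then the Grothendieck topology $J$ on $\mathrm{Map}(\mathcal{Q})$ defined, for each object $X$, by $$J(X):=\Big\{S \text{ is a sieve on } X \text{ in } \mathrm{Map}(\mathcal{Q})\ \Big|\ 1_X=\bigvee_{s\in S}s\circ s^*\Big\}$$ is subcanonical (i.e. each representable presheaf on $\mathrm{Map}(\mathcal{Q})$ is a sheaf for $J$).
   Context: A quantaloid $\mathcal{Q}$ is a category enriched in $\mathrm{Sup}$, the category of complete lattices and supremum-preserving functions: each hom is a complete lattice and composition preserves arbitrary suprema in each variable. It is small if it has a set of objects. Equivalence of quantaloids is meant in the $\mathrm{Sup}$-enriched sense. An arrow $f\colon X\to Y$ is a left adjoint if there is $f^*\colon Y\to X$ (its right adjoint) with $1_X\leq f^*\circ f$ and $f\circ f^*\leq 1_Y$. $\mathrm{Map}(\mathcal{Q})$ is the category with the objects of $\mathcal{Q}$ and the left adjoints of $\mathcal{Q}$ as arrows. In a category $\mathcal{C}$, a span $(f,g)$ from $X$ to $Y$ is a pair of arrows $f\colon U\to Y$, $g\colon U\to X$ with common domain. For a small category $\mathcal{C}$, a crible $R$ from $X$ to $Y$ is a set of spans from $X$ to $Y$ such that $(f,g)\in R$ implies $(f\circ h,g\circ h)\in R$ for every $h$ with codomain $\mathrm{dom}(f)$. The quantaloid $\mathcal{R}(\mathcal{C})$ has the objects of $\mathcal{C}$ as objects and cribles as arrows; for $R\colon X\to Y$ and $S\colon Y\to Z$, $S\circ R$ consists of those $(f,g)$ for which there is $t$ in $\mathcal{C}$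 with $(f,t)\in S$ and $(t,g)\in R$; the identity on $X$ is $\{(f,f)\mid \mathrm{cod}(f)=X\}$; suprema of arrows are unions. For a Grothendieck topology $J$ on $\mathcal{C}$ and a crible $R$ from $C$ to $D$, put $$j(R)=\{(f,g)\text{ a span from }C\text{ to }D\mid \exists S\in J(\mathrm{dom}(f)):\ \forall s\in S,\ (f\circ s,g\circ s)\in R\}.$$ The quantaloid $\mathcal{R}(\mathcal{C},J)$ has the objects of $\mathcal{C}$ as objects and the cribles $R$ with $j(R)=R$ as arrows, with composition $j(S\circ R)$, identities $j(\mathrm{id}_X)$ and suprema $j(\bigcup_i R_i)$. A small quantaloid of closed cribles is a small quantaloid equivalent to $\mathcal{R}(\mathcal{C},J)$ for some small site $(\mathcal{C},J)$. It is known that, when $\mathcal{Q}$ is a small quantaloid of closed cribles, the assignment $J$ in the claim is indeed a Grothendieck topology on $\mathrm{Map}(\mathcal{Q})$, and that $\mathcal{Q}\cong\mathcal{R}(\mathrm{Map}(\mathcal{Q}),J)$. *)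

theory Defs
  imports "HOL-Algebra.Complete_Lattice"
begin

section \<open>Small categories\<close>

text \<open>Since objects and arrows form sets over HOL types, every category below is small.  Arrows know
  their domain and codomain, and \<open>g \<cdot> f\<close> is ``first \<open>f\<close>, then \<open>g\<close>''.\<close>

record ('o, 'a) cat =
  Obj :: "'o set"
  Arr :: "'a set"
  Dom :: "'a \<Rightarrow> 'o"
  Cod :: "'a \<Rightarrow> 'o"
  Ident :: "'o \<Rightarrow> 'a"
  Comp :: "'a \<Rightarrow> 'a \<Rightarrow> 'a"  (infixl "\<cdot>\<index>" 70)

definition hom :: "('o, 'a, 'm) cat_scheme \<Rightarrow> 'o \<Rightarrow> 'o \<Rightarrow> 'a set" where
  "hom C X Y = {f \<in> Arr C. Dom C f = X \<and> Cod C f = Y}"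

locale category =
  fixes C :: "('o, 'a, 'm) cat_scheme" (structure)
  assumes dom_in_Obj: "f \<in> Arr C \<Longrightarrow> Dom C f \<in> Obj C"
    and cod_in_Obj: "f \<in> Arr C \<Longrightarrow> Cod C f \<in> Obj C"
    and ident_in_hom: "X \<in> Obj C \<Longrightarrow> Ident C X \<in> hom C X X"
    and comp_in_hom: "\<lbrakk>f \<in> hom C X Y; g \<in> hom C Y Z\<rbrakk> \<Longrightarrow> g \<cdot> f \<in> hom C X Z"
    and comp_ident_left: "f \<in> hom C X Y \<Longrightarrow> Ident C Y \<cdot> f = f"
    and comp_ident_right: "f \<in> hom C X Y \<Longrightarrow> f \<cdot> Ident C X = f"
    and comp_assoc: "\<lbrakk>f \<in> hom C W X; g \<in> hom C X Y; h \<in> hom C Y Z\<rbrakk> \<Longrightarrow> (h \<cdot> g) \<cdot> f = h \<cdot> (g \<cdot> f)"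

definition iso :: "('o, 'a, 'm) cat_scheme \<Rightarrow> 'a \<Rightarrow> bool" where
  "iso C f \<longleftrightarrow> f \<in> Arr C \<and>
     (\<exists>g \<in> hom C (Cod C f) (Dom C f).
        g \<cdot>\<^bsub>C\<^esub> f = Ident C (Dom C f) \<and> f \<cdot>\<^bsub>C\<^esub> g = Ident C (Cod C f))"

record ('o, 'a, 'p, 'b) func =
  ob :: "'o \<Rightarrow> 'p"
  ar :: "'a \<Rightarrow> 'b"

definition id_func :: "('o, 'a, 'o, 'a) func" where
  "id_func = \<lparr>ob = (\<lambda>X. X), ar = (\<lambda>f. f)\<rparr>"

definition comp_func ::
  "('p, 'b, 'q, 'c) func \<Rightarrow> ('o, 'a, 'p, 'b) func \<Rightarrow> ('o, 'a, 'q, 'c) func" where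
  "comp_func G F = \<lparr>ob = (\<lambda>X. ob G (ob F X)), ar = (\<lambda>f. ar G (ar F f))\<rparr>"

definition is_functor ::
  "('o, 'a, 'm) cat_scheme \<Rightarrow> ('p, 'b, 'n) cat_scheme \<Rightarrow> ('o, 'a, 'p, 'b) func \<Rightarrow> bool" where
  "is_functor C D F \<longleftrightarrow>
     (\<forall>X \<in> Obj C. ob F X \<in> Obj D) \<and>
     (\<forall>f \<in> Arr C. ar F f \<in> hom D (ob F (Dom C f)) (ob F (Cod C f))) \<and>
     (\<forall>X \<in> Obj C. ar F (Ident C X) = Ident D (ob F X)) \<and>
     (\<forall>f \<in> Arr C. \<forall>g \<in> Arr C. Cod C f = Dom C g \<longrightarrow>
        ar F (g \<cdot>\<^bsub>C\<^esub> f) = ar F g \<cdot>\<^bsub>D\<^esub> ar F f)"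

definition natural_iso ::
  "('o, 'a, 'm) cat_scheme \<Rightarrow> ('p, 'b, 'n) cat_scheme \<Rightarrow>
   ('o, 'a, 'p, 'b) func \<Rightarrow> ('o, 'a, 'p, 'b) func \<Rightarrow> ('o \<Rightarrow> 'b) \<Rightarrow> bool" where
  "natural_iso C D F G \<eta> \<longleftrightarrow>
     (\<forall>X \<in> Obj C. \<eta> X \<in> hom D (ob F X) (ob G X) \<and> iso D (\<eta> X)) \<and>
     (\<forall>f \<in> Arr C. \<eta> (Cod C f) \<cdot>\<^bsub>D\<^esub> ar F f = ar G f \<cdot>\<^bsub>D\<^esub> \<eta> (Dom C f))"

definition naturally_isomorphic ::
  "('o, 'a, 'm) cat_scheme \<Rightarrow> ('p, 'b, 'n) cat_scheme \<Rightarrow>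
   ('o, 'a, 'p, 'b) func \<Rightarrow> ('o, 'a, 'p, 'b) func \<Rightarrow> bool" where
  "naturally_isomorphic C D F G \<longleftrightarrow> (\<exists>\<eta>. natural_iso C D F G \<eta>)"


section \<open>Sites and sheaves\<close>

definition sieve :: "('o, 'a, 'm) cat_scheme \<Rightarrow> 'o \<Rightarrow> 'a set \<Rightarrow> bool" where
  "sieve C X S \<longleftrightarrow> X \<in> Obj C \<and> S \<subseteq> {f \<in> Arr C. Cod C f = X} \<and>
     (\<forall>f \<in> S. \<forall>h \<in> Arr C. Cod C h = Dom C f \<longrightarrow> f \<cdot>\<^bsub>C\<^esub> h \<in> S)"

definition pullback_sieve :: "('o, 'a, 'm) cat_scheme \<Rightarrow> 'a \<Rightarrow> 'a set \<Rightarrow> 'a set" where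
  "pullback_sieve C h S = {g \<in> Arr C. Cod C g = Dom C h \<and> h \<cdot>\<^bsub>C\<^esub> g \<in> S}"

definition grothendieck_topology ::
  "('o, 'a, 'm) cat_scheme \<Rightarrow> ('o \<Rightarrow> 'a set set) \<Rightarrow> bool" where
  "grothendieck_topology C J \<longleftrightarrow>
     (\<forall>X \<in> Obj C. \<forall>S \<in> J X. sieve C X S) \<and>
     (\<forall>X \<in> Obj C. {f \<in> Arr C. Cod C f = X} \<in> J X) \<and>
     (\<forall>X \<in> Obj C. \<forall>S \<in> J X. \<forall>h \<in> Arr C. Cod C h = X \<longrightarrow> pullback_sieve C h S \<in> J (Dom C h)) \<and>
     (\<forall>X \<in> Obj C. \<forall>S \<in> J X. \<forall>T. sieve C X T \<longrightarrow>
        (\<forall>s \<in> S. pullback_sieve C s T \<in> J (Dom C s)) \<longrightarrow> T \<in> J X)"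

locale site = category C
  for C :: "('o, 'a, 'm) cat_scheme" (structure) and J :: "'o \<Rightarrow> 'a set set" +
  assumes topology: "grothendieck_topology C J"

text \<open>A presheaf is a contravariant set-valued functor: \<open>sec P X\<close> is the set of sections over \<open>X\<close>,
  and \<open>res P f\<close> restricts sections along \<open>f\<close>.\<close>

record ('o, 'a, 'x) presheaf =
  sec :: "'o \<Rightarrow> 'x set"
  res :: "'a \<Rightarrow> 'x \<Rightarrow> 'x"

definition is_presheaf :: "('o, 'a, 'm) cat_scheme \<Rightarrow> ('o, 'a, 'x) presheaf \<Rightarrow> bool" where
  "is_presheaf C P \<longleftrightarrow>
     (\<forall>f \<in> Arr C. \<forall>x \<in> sec P (Cod C f). res P f x \<in> sec P (Dom C f)) \<and>
     (\<forall>X \<in> Obj C. \<forall>x \<in> sec P X. res P (Ident C X) x = x) \<and>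
     (\<forall>f \<in> Arr C. \<forall>g \<in> Arr C. Cod C f = Dom C g \<longrightarrow>
        (\<forall>x \<in> sec P (Cod C g). res P (g \<cdot>\<^bsub>C\<^esub> f) x = res P f (res P g x)))"

definition matching_family ::
  "('o, 'a, 'm) cat_scheme \<Rightarrow> ('o, 'a, 'x) presheaf \<Rightarrow> 'a set \<Rightarrow> ('a \<Rightarrow> 'x) \<Rightarrow> bool" where
  "matching_family C P S x \<longleftrightarrow>
     (\<forall>s \<in> S. x s \<in> sec P (Dom C s)) \<and>
     (\<forall>s \<in> S. \<forall>h \<in> Arr C. Cod C h = Dom C s \<longrightarrow> x (s \<cdot>\<^bsub>C\<^esub> h) = res P h (x s))"

definition is_sheaf ::
  "('o, 'a, 'm) cat_scheme \<Rightarrow> ('o \<Rightarrow> 'a set set) \<Rightarrow> ('o, 'a, 'x) presheaf \<Rightarrow> bool" where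
  "is_sheaf C J P \<longleftrightarrow> is_presheaf C P \<and>
     (\<forall>X \<in> Obj C. \<forall>S \<in> J X. \<forall>x. matching_family C P S x \<longrightarrow>
        (\<exists>!y. y \<in> sec P X \<and> (\<forall>s \<in> S. res P s y = x s)))"

definition representable :: "('o, 'a, 'm) cat_scheme \<Rightarrow> 'o \<Rightarrow> ('o, 'a, 'a) presheaf" where
  "representable C Y = \<lparr>sec = (\<lambda>X. hom C X Y), res = (\<lambda>f g. g \<cdot>\<^bsub>C\<^esub> f)\<rparr>"

definition subcanonical :: "('o, 'a, 'm) cat_scheme \<Rightarrow> ('o \<Rightarrow> 'a set set) \<Rightarrow> bool" where
  "subcanonical C J \<longleftrightarrow> (\<forall>Y \<in> Obj C. is_sheaf C J (representable C Y))"


section \<open>Quantaloids\<close>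

record ('o, 'a) quant = "('o, 'a) cat" +
  qle :: "'a \<Rightarrow> 'a \<Rightarrow> bool"

definition hom_order :: "('o, 'a, 'm) quant_scheme \<Rightarrow> 'o \<Rightarrow> 'o \<Rightarrow> 'a gorder" where
  "hom_order Q X Y = \<lparr>carrier = hom Q X Y, eq = (=), le = qle Q\<rparr>"

abbreviation hom_Sup :: "('o, 'a, 'm) quant_scheme \<Rightarrow> 'o \<Rightarrow> 'o \<Rightarrow> 'a set \<Rightarrow> 'a" where
  "hom_Sup Q X Y A \<equiv> \<Squnion>\<^bsub>hom_order Q X Y\<^esub> A"

locale quantaloid = category Q
  for Q :: "('o, 'a, 'm) quant_scheme" (structure) +
  assumes complete: "\<lbrakk>X \<in> Obj Q; Y \<in> Obj Q\<rbrakk> \<Longrightarrow> complete_lattice (hom_order Q X Y)"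
    and comp_Sup_right:
      "\<lbrakk>X \<in> Obj Q; A \<subseteq> hom Q X Y; g \<in> hom Q Y Z\<rbrakk> \<Longrightarrow>
        g \<cdot> hom_Sup Q X Y A = hom_Sup Q X Z ((\<lambda>f. g \<cdot> f) ` A)"
    and comp_Sup_left:
      "\<lbrakk>Z \<in> Obj Q; f \<in> hom Q X Y; A \<subseteq> hom Q Y Z\<rbrakk> \<Longrightarrow>
        hom_Sup Q Y Z A \<cdot> f = hom_Sup Q X Z ((\<lambda>g. g \<cdot> f) ` A)"

definition is_Sup_functor ::
  "('o, 'a, 'm) quant_scheme \<Rightarrow> ('p, 'b, 'n) quant_scheme \<Rightarrow> ('o, 'a, 'p, 'b) func \<Rightarrow> bool" where
  "is_Sup_functor Q R F \<longleftrightarrow> is_functor Q R F \<and>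
     (\<forall>X \<in> Obj Q. \<forall>Y \<in> Obj Q. \<forall>A \<subseteq> hom Q X Y.
        ar F (hom_Sup Q X Y A) = hom_Sup R (ob F X) (ob F Y) (ar F ` A))"

text \<open>The forgetful functor from sup-lattices to sets is faithful, so a \<open>Sup\<close>-enriched natural
  transformation is just an ordinary one.\<close>

definition quantaloid_equivalent ::
  "('o, 'a, 'm) quant_scheme \<Rightarrow> ('p, 'b, 'n) quant_scheme \<Rightarrow> bool" where
  "quantaloid_equivalent Q R \<longleftrightarrow>
     (\<exists>F G. is_Sup_functor Q R F \<and> is_Sup_functor R Q G \<and>
        naturally_isomorphic Q Q (comp_func G F) id_func \<and>
        naturally_isomorphic R R (comp_func F G) id_func)"

definition adjoint_pair :: "('o, 'a, 'm) quant_scheme \<Rightarrow> 'a \<Rightarrow> 'a \<Rightarrow> bool" where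
  "adjoint_pair Q f g \<longleftrightarrow> f \<in> Arr Q \<and> g \<in> hom Q (Cod Q f) (Dom Q f) \<and>
     qle Q (Ident Q (Dom Q f)) (g \<cdot>\<^bsub>Q\<^esub> f) \<and> qle Q (f \<cdot>\<^bsub>Q\<^esub> g) (Ident Q (Cod Q f))"

definition left_adjoint :: "('o, 'a, 'm) quant_scheme \<Rightarrow> 'a \<Rightarrow> bool" where
  "left_adjoint Q f \<longleftrightarrow> (\<exists>g. adjoint_pair Q f g)"

text \<open>In a quantaloid an arrow has at most one right adjoint, so this is the right adjoint of \<open>f\<close> whenever
  \<open>f\<close> is a left adjoint.\<close>

definition right_adj :: "('o, 'a, 'm) quant_scheme \<Rightarrow> 'a \<Rightarrow> 'a" where
  "right_adj Q f = (THE g. adjoint_pair Q f g)"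

definition MapCat :: "('o, 'a, 'm) quant_scheme \<Rightarrow> ('o, 'a) cat" where
  "MapCat Q = \<lparr>Obj = Obj Q, Arr = {f \<in> Arr Q. left_adjoint Q f},
     Dom = Dom Q, Cod = Cod Q, Ident = Ident Q, Comp = Comp Q\<rparr>"

definition map_topology :: "('o, 'a, 'm) quant_scheme \<Rightarrow> 'o \<Rightarrow> 'a set set" where
  "map_topology Q X = {S. sieve (MapCat Q) X S \<and>
     Ident Q X = hom_Sup Q X X ((\<lambda>s. s \<cdot>\<^bsub>Q\<^esub> right_adj Q s) ` S)}"


section \<open>Closed cribles\<close>

text \<open>A span from \<open>X\<close> to \<open>Y\<close> is a pair \<open>(f, g)\<close> whose first leg ends in \<open>Y\<close> and whose second leg
  ends in \<open>X\<close>.\<close>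

definition spans :: "('o, 'a, 'm) cat_scheme \<Rightarrow> 'o \<Rightarrow> 'o \<Rightarrow> ('a \<times> 'a) set" where
  "spans C X Y =
     {(f, g). f \<in> Arr C \<and> g \<in> Arr C \<and> Dom C f = Dom C g \<and> Cod C f = Y \<and> Cod C g = X}"

definition crible :: "('o, 'a, 'm) cat_scheme \<Rightarrow> 'o \<Rightarrow> 'o \<Rightarrow> ('a \<times> 'a) set \<Rightarrow> bool" where
  "crible C X Y R \<longleftrightarrow> R \<subseteq> spans C X Y \<and>
     (\<forall>(f, g) \<in> R. \<forall>h \<in> Arr C. Cod C h = Dom C f \<longrightarrow> (f \<cdot>\<^bsub>C\<^esub> h, g \<cdot>\<^bsub>C\<^esub> h) \<in> R)"

definition crible_comp ::
  "('o, 'a, 'm) cat_scheme \<Rightarrow> ('a \<times> 'a) set \<Rightarrow> ('a \<times> 'a) set \<Rightarrow> ('a \<times> 'a) set" where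
  "crible_comp C S R = {(f, g). \<exists>t \<in> Arr C. (f, t) \<in> S \<and> (t, g) \<in> R}"

definition crible_id :: "('o, 'a, 'm) cat_scheme \<Rightarrow> 'o \<Rightarrow> ('a \<times> 'a) set" where
  "crible_id C X = {(f, f) | f. f \<in> Arr C \<and> Cod C f = X}"

definition crible_closure ::
  "('o, 'a, 'm) cat_scheme \<Rightarrow> ('o \<Rightarrow> 'a set set) \<Rightarrow> 'o \<Rightarrow> 'o \<Rightarrow> ('a \<times> 'a) set \<Rightarrow> ('a \<times> 'a) set" where
  "crible_closure C J X Y R =
     {(f, g) \<in> spans C X Y. \<exists>S \<in> J (Dom C f). \<forall>s \<in> S. (f \<cdot>\<^bsub>C\<^esub> s, g \<cdot>\<^bsub>C\<^esub> s) \<in> R}"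

text \<open>An arrow \<open>X \<rightarrow> Y\<close> is a closed crible \<open>R\<close> stored as \<open>(X, R, Y)\<close>: the set \<open>R\<close> alone need not
  determine its domain and codomain (it may be empty).  The order is inclusion; the resulting suprema
  are the closures of unions.\<close>

definition closed_cribles ::
  "('o, 'a, 'm) cat_scheme \<Rightarrow> ('o \<Rightarrow> 'a set set) \<Rightarrow> ('o, 'o \<times> ('a \<times> 'a) set \<times> 'o) quant" where
  "closed_cribles C J = \<lparr>Obj = Obj C,
     Arr = {(X, R, Y). X \<in> Obj C \<and> Y \<in> Obj C \<and> crible C X Y R \<and> crible_closure C J X Y R = R},
     Dom = (\<lambda>(X, R, Y). X),
     Cod = (\<lambda>(X, R, Y). Y),
     Ident = (\<lambda>X. (X, crible_closure C J X X (crible_id C X), X)),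
     Comp = (\<lambda>(_, S, Z) (X, R, _). (X, crible_closure C J X Z (crible_comp C S R), Z)),
     qle = (\<lambda>(_, R, _) (_, S, _). R \<subseteq> S)\<rparr>"

end

theory Submission
  imports Defs
begin

text \<open>
  Call a quantaloid map-discrete if its left adjoints are ordered by equality, and weakly tabular if
  every arrow is a supremum of arrows \<open>f \<cdot> g\<^sup>*\<close> with \<open>f\<close> and \<open>g\<close> left adjoints.  In such a quantaloid
  a matching family \<open>x\<close> on a covering sieve \<open>S\<close> is glued by \<open>y = \<Or> x s \<cdot> s\<^sup>*\<close>, with right adjoint
  \<open>\<Or> s \<cdot> (x s)\<^sup>*\<close>: the counit inequality needs \<open>x s \<cdot> s\<^sup>* \<cdot> t \<le> x t\<close>, and after writing \<open>s\<^sup>* \<cdot> t\<close> as a supremum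
  of \<open>f \<cdot> g\<^sup>*\<close> one gets \<open>s \<cdot> f \<le> t \<cdot> g\<close>, hence \<open>s \<cdot> f = t \<cdot> g\<close> and \<open>x s \<cdot> f = x t \<cdot> g\<close>.  Conversely
  \<open>1 = \<Or> s \<cdot> s\<^sup>*\<close> forces any gluing to be \<open>y\<close>.  Both properties are invariant under equivalence, and
  both hold for closed cribles: a crible is the supremum of the spans \<open>(f, g)\<close> that it contains, each
  seen as the graph of \<open>f\<close> after the converse graph of \<open>g\<close>.
\<close>

section \<open>Map-discrete and weakly tabular quantaloids\<close>

definition map_discrete :: "('o, 'a, 'm) quant_scheme \<Rightarrow> bool" where
  "map_discrete Q \<longleftrightarrow> (\<forall>X Y. \<forall>f \<in> hom Q X Y. \<forall>g \<in> hom Q X Y.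
     left_adjoint Q f \<longrightarrow> left_adjoint Q g \<longrightarrow> qle Q f g \<longrightarrow> f = g)"

text \<open>The right adjoint of \<open>g\<close> is a separate variable instead of the definite
  description \<open>right_adj Q g\<close>, so the definition can be used in
  \<open>closed_cribles C J\<close> without first establishing that right adjoints are unique
  there.\<close>

definition map_spans :: "('o, 'a, 'm) quant_scheme \<Rightarrow> 'o \<Rightarrow> 'o \<Rightarrow> 'a set" where
  "map_spans Q X Y = {f \<cdot>\<^bsub>Q\<^esub> g' | U f g g'.
     f \<in> hom Q U Y \<and> left_adjoint Q f \<and> g \<in> hom Q U X \<and> adjoint_pair Q g g'}"

definition weakly_tabular :: "('o, 'a, 'm) quant_scheme \<Rightarrow> bool" where
  "weakly_tabular Q \<longleftrightarrow> (\<forall>X Y. \<forall>r \<in> hom Q X Y. \<exists>A \<subseteq> map_spans Q X Y. r = hom_Sup Q X Y A)"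

section \<open>Suprema and order in a single hom\<close>

lemma hom_order_lub:
  assumes "complete_lattice (hom_order Q X Y)" "A \<subseteq> hom Q X Y"
  shows "hom_Sup Q X Y A \<in> hom Q X Y"
    and "a \<in> A \<Longrightarrow> qle Q a (hom_Sup Q X Y A)"
    and "b \<in> hom Q X Y \<Longrightarrow> (\<And>a. a \<in> A \<Longrightarrow> qle Q a b) \<Longrightarrow> qle Q (hom_Sup Q X Y A) b"
proof -
  interpret L: complete_lattice "hom_order Q X Y" by fact
  have A: "A \<subseteq> carrier (hom_order Q X Y)" using assms(2) by (simp add: hom_order_def)
  show "hom_Sup Q X Y A \<in> hom Q X Y"
    using L.sup_closed[OF A] by (simp add: hom_order_def)
  show "qle Q a (hom_Sup Q X Y A)" if "a \<in> A"
    using L.sup_upper[OF A that] by (simp add: hom_order_def)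
  show "qle Q (hom_Sup Q X Y A) b" if "b \<in> hom Q X Y" "\<And>a. a \<in> A \<Longrightarrow> qle Q a b"
    using L.sup_least[OF A, of b] that by (simp add: hom_order_def)
qed

lemma hom_order_partial:
  assumes "complete_lattice (hom_order Q X Y)"
  shows "a \<in> hom Q X Y \<Longrightarrow> qle Q a a"
    and "a \<in> hom Q X Y \<Longrightarrow> b \<in> hom Q X Y \<Longrightarrow> qle Q a b \<Longrightarrow> qle Q b a \<Longrightarrow> a = b"
    and "a \<in> hom Q X Y \<Longrightarrow> b \<in> hom Q X Y \<Longrightarrow> c \<in> hom Q X Y \<Longrightarrow>
      qle Q a b \<Longrightarrow> qle Q b c \<Longrightarrow> qle Q a c"
proof -
  interpret L: complete_lattice "hom_order Q X Y" by fact
  show "a \<in> hom Q X Y \<Longrightarrow> qle Q a a"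
    using L.le_refl[of a] by (simp add: hom_order_def)
  show "a \<in> hom Q X Y \<Longrightarrow> b \<in> hom Q X Y \<Longrightarrow> qle Q a b \<Longrightarrow> qle Q b a \<Longrightarrow> a = b"
    using L.le_antisym[of a b] by (simp add: hom_order_def)
  show "a \<in> hom Q X Y \<Longrightarrow> b \<in> hom Q X Y \<Longrightarrow> c \<in> hom Q X Y \<Longrightarrow>
      qle Q a b \<Longrightarrow> qle Q b c \<Longrightarrow> qle Q a c"
    using L.le_trans[of a b c] by (simp add: hom_order_def)
qed

text \<open>Turns an inequality into an equation between suprema. This is how preservation of
  suprema yields monotonicity, both for composition and for Sup-functors. Like the two preceding
  lemmas it assumes completeness of one hom only, so it serves for quantaloids and for closed
  cribles.\<close>

lemma hom_Sup_pair:
  assumes "complete_lattice (hom_order Q X Y)" "f \<in> hom Q X Y" "g \<in> hom Q X Y" "qle Q f g"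
  shows "hom_Sup Q X Y {f, g} = g"
proof -
  have A: "{f, g} \<subseteq> hom Q X Y" using assms by simp
  show ?thesis
  proof (rule hom_order_partial(2)[OF assms(1)])
    show "qle Q (hom_Sup Q X Y {f, g}) g"
      by (rule hom_order_lub(3)[OF assms(1) A assms(3)]) (use assms(3,4) hom_order_partial(1)[OF assms(1)] in blast)
  qed (use hom_order_lub(1,2)[OF assms(1) A] assms(3) in blast)+
qed

context category
begin

lemma comp_Arr: "\<lbrakk>f \<in> Arr C; g \<in> Arr C; Cod C f = Dom C g\<rbrakk> \<Longrightarrow> g \<cdot> f \<in> Arr C"
  and Dom_comp: "\<lbrakk>f \<in> Arr C; g \<in> Arr C; Cod C f = Dom C g\<rbrakk> \<Longrightarrow> Dom C (g \<cdot> f) = Dom C f"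
  and Cod_comp: "\<lbrakk>f \<in> Arr C; g \<in> Arr C; Cod C f = Dom C g\<rbrakk> \<Longrightarrow> Cod C (g \<cdot> f) = Cod C g"
  using comp_in_hom[of f "Dom C f" "Cod C f" g "Cod C g"] by (simp_all add: hom_def)

lemma ident_Arr: "X \<in> Obj C \<Longrightarrow> Ident C X \<in> Arr C"
  and Dom_ident: "X \<in> Obj C \<Longrightarrow> Dom C (Ident C X) = X"
  and Cod_ident: "X \<in> Obj C \<Longrightarrow> Cod C (Ident C X) = X"
  using ident_in_hom[of X] by (simp_all add: hom_def)

lemmas typing = hom_def comp_Arr Dom_comp Cod_comp ident_Arr Dom_ident Cod_ident

lemma assoc:
  "\<lbrakk>f \<in> Arr C; g \<in> Arr C; h \<in> Arr C; Cod C f = Dom C g; Cod C g = Dom C h\<rbrakk> \<Longrightarrow> (h \<cdot> g) \<cdot> f = h \<cdot> (g \<cdot> f)"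
  using comp_assoc[of f "Dom C f" "Cod C f" g "Cod C g" h "Cod C h"] by (simp add: hom_def)

end

section \<open>Monotone composition and the calculus of adjoints\<close>

context quantaloid
begin

lemma hom_Obj: "f \<in> hom Q X Y \<Longrightarrow> X \<in> Obj Q \<and> Y \<in> Obj Q"
  using dom_in_Obj cod_in_Obj by (auto simp: hom_def)

lemma hom_complete: "f \<in> hom Q X Y \<Longrightarrow> complete_lattice (hom_order Q X Y)"
  using hom_Obj complete by blast

lemma qle_refl: "f \<in> hom Q X Y \<Longrightarrow> qle Q f f"
  using hom_order_partial(1) hom_complete by metis

lemma qle_trans:
  "\<lbrakk>qle Q f g; qle Q g h; f \<in> hom Q X Y; g \<in> hom Q X Y; h \<in> hom Q X Y\<rbrakk> \<Longrightarrow> qle Q f h"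
  using hom_order_partial(3) hom_complete by metis

lemma qle_antisym:
  "\<lbrakk>qle Q f g; qle Q g f; f \<in> hom Q X Y; g \<in> hom Q X Y\<rbrakk> \<Longrightarrow> f = g"
  using hom_order_partial(2) hom_complete by metis

lemma comp_mono_right:
  assumes "f \<in> hom Q X Y" "f' \<in> hom Q X Y" "qle Q f f'" "g \<in> hom Q Y Z"
  shows "qle Q (g \<cdot> f) (g \<cdot> f')"
proof -
  have "g \<cdot> hom_Sup Q X Y {f, f'} = hom_Sup Q X Z ((\<lambda>f. g \<cdot> f) ` {f, f'})"
    using comp_Sup_right[of X "{f,f'}" Y g Z] hom_Obj assms by blast
  then have "g \<cdot> f' = hom_Sup Q X Z {g \<cdot> f, g \<cdot> f'}"
    using hom_Sup_pair[OF hom_complete[OF assms(1)] assms(1-3)] by simp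
  then show ?thesis
    using hom_order_lub(2)[OF hom_complete, of "g \<cdot> f" X Z "{g \<cdot> f, g \<cdot> f'}" "g \<cdot> f"]
      assms by (simp add: typing)
qed

lemma comp_mono_left:
  assumes "f \<in> hom Q X Y" "g \<in> hom Q Y Z" "g' \<in> hom Q Y Z" "qle Q g g'"
  shows "qle Q (g \<cdot> f) (g' \<cdot> f)"
proof -
  have "hom_Sup Q Y Z {g, g'} \<cdot> f = hom_Sup Q X Z ((\<lambda>g. g \<cdot> f) ` {g, g'})"
    using comp_Sup_left[of Z f X Y "{g,g'}"] hom_Obj assms by blast
  then have "g' \<cdot> f = hom_Sup Q X Z {g \<cdot> f, g' \<cdot> f}"
    using hom_Sup_pair[OF hom_complete[OF assms(2)] assms(2-4)] by simp
  then show ?thesis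
    using hom_order_lub(2)[OF hom_complete, of "g \<cdot> f" X Z "{g \<cdot> f, g' \<cdot> f}" "g \<cdot> f"]
      assms by (simp add: typing)
qed

lemma adjoint_pairD:
  assumes "adjoint_pair Q f f'" "f \<in> hom Q X Y"
  shows "f' \<in> hom Q Y X" "qle Q (Ident Q X) (f' \<cdot> f)" "qle Q (f \<cdot> f') (Ident Q Y)"
  using assms by (auto simp: adjoint_pair_def hom_def)

lemma adjoint_pairI:
  assumes "f \<in> hom Q X Y" "f' \<in> hom Q Y X" "qle Q (Ident Q X) (f' \<cdot> f)" "qle Q (f \<cdot> f') (Ident Q Y)"
  shows "adjoint_pair Q f f'"
  using assms by (auto simp: adjoint_pair_def hom_def)

text \<open>The chain is \<open>g' \<le> f' f g' \<le> f' g g' \<le> f'\<close>: unit of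
  \<open>f\<close>, then \<open>f \<le> g\<close>, then counit of \<open>g\<close>. The code bounds
  \<open>f g'\<close> by the identity before composing with \<open>f'\<close>. Used in both
  directions with equal left adjoints, it gives uniqueness of right adjoints.\<close>

lemma right_adjoint_antimono:
  assumes f: "adjoint_pair Q f f'" "f \<in> hom Q X Y" and g: "adjoint_pair Q g g'" "g \<in> hom Q X Y"
    and le: "qle Q f g"
  shows "qle Q g' f'"
proof -
  note F = adjoint_pairD[OF f] and G = adjoint_pairD[OF g]
  note O = hom_Obj[OF f(2)]
  have "qle Q (Ident Q X \<cdot> g') (f' \<cdot> f \<cdot> g')"
    using comp_mono_left[OF G(1) _ _ F(2)] O f(2) F(1) by (simp add: typing)
  then have 1: "qle Q g' (f' \<cdot> f \<cdot> g')" using comp_ident_left[OF G(1)] by simp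
  have fg: "f \<cdot> g' \<in> hom Q Y Y" "g \<cdot> g' \<in> hom Q Y Y"
    using G(1) f(2) g(2) by (simp_all add: typing)
  have "qle Q (f \<cdot> g') (g \<cdot> g')" using comp_mono_left[OF G(1) f(2) g(2) le] .
  then have "qle Q (f \<cdot> g') (Ident Q Y)" using qle_trans[OF _ G(3)] fg ident_in_hom O by blast
  then have "qle Q (f' \<cdot> (f \<cdot> g')) (f' \<cdot> Ident Q Y)"
    using comp_mono_right[OF fg(1) _ _ F(1)] O by (simp add: typing)
  then have "qle Q (f' \<cdot> f \<cdot> g') f'"
    using comp_ident_right[OF F(1)] comp_assoc[OF G(1) f(2) F(1)] by simp
  then show ?thesis
    using qle_trans[OF 1, of f' Y X] G(1) F(1) f(2) by (simp add: typing)
qed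

lemma right_adj_eq:
  assumes "adjoint_pair Q f f'"
  shows "right_adj Q f = f'"
  unfolding right_adj_def
proof (rule the_equality)
  fix g assume g: "adjoint_pair Q f g"
  have f: "f \<in> hom Q (Dom Q f) (Cod Q f)" using assms by (auto simp: adjoint_pair_def hom_def)
  show "g = f'"
    using right_adjoint_antimono[OF assms f g f qle_refl[OF f]]
      right_adjoint_antimono[OF g f assms f qle_refl[OF f]]
      qle_antisym adjoint_pairD(1)[OF g f] adjoint_pairD(1)[OF assms f] by blast
qed (fact assms)

lemma adjoint_right_adj: "left_adjoint Q f \<Longrightarrow> adjoint_pair Q f (right_adj Q f)"
  using right_adj_eq unfolding left_adjoint_def by auto

lemma map_spans_hom: "map_spans Q X Y \<subseteq> hom Q X Y"
  using comp_in_hom[OF adjoint_pairD(1)] unfolding map_spans_def by blast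

text \<open>The unit of \<open>g\<close> is inserted between \<open>f'\<close> and \<open>f\<close>,
  and the counit of \<open>f\<close> is cancelled between \<open>g\<close> and
  \<open>g'\<close>.\<close>

lemma adjoint_comp:
  assumes f: "adjoint_pair Q f f'" "f \<in> hom Q X Y" and g: "adjoint_pair Q g g'" "g \<in> hom Q Y Z"
  shows "adjoint_pair Q (g \<cdot> f) (f' \<cdot> g')"
proof -
  note F = adjoint_pairD[OF f] and G = adjoint_pairD[OF g]
  note O = hom_Obj[OF f(2)] hom_Obj[OF g(2)]
  have iY: "Ident Q Y \<in> hom Q Y Y" using ident_in_hom O by blast
  have gf: "g' \<cdot> g \<in> hom Q Y Y" "f \<cdot> f' \<in> hom Q Y Y"
    using f(2) g(2) F(1) G(1) by (simp_all add: typing)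
  have "qle Q (f' \<cdot> (Ident Q Y \<cdot> f)) (f' \<cdot> ((g' \<cdot> g) \<cdot> f))"
    using comp_mono_right[OF _ _ comp_mono_left[OF f(2) iY gf(1) G(2)] F(1)]
      f(2) iY gf by (simp add: typing)
  moreover have "f' \<cdot> ((g' \<cdot> g) \<cdot> f) = (f' \<cdot> g') \<cdot> (g \<cdot> f)"
    using f(2) g(2) F(1) G(1) by (simp add: typing assoc)
  ultimately have "qle Q (f' \<cdot> f) ((f' \<cdot> g') \<cdot> (g \<cdot> f))" using comp_ident_left[OF f(2)] by simp
  then have 1: "qle Q (Ident Q X) ((f' \<cdot> g') \<cdot> (g \<cdot> f))"
    using qle_trans[OF F(2), of _ X X] O f(2) g(2) F(1) G(1) by (simp add: typing)
  have "qle Q (g \<cdot> ((f \<cdot> f') \<cdot> g')) (g \<cdot> (Ident Q Y \<cdot> g'))"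
    using comp_mono_right[OF _ _ comp_mono_left[OF G(1) gf(2) iY F(3)] g(2)]
      G(1) iY gf by (simp add: typing)
  moreover have "g \<cdot> ((f \<cdot> f') \<cdot> g') = (g \<cdot> f) \<cdot> (f' \<cdot> g')"
    using f(2) g(2) F(1) G(1) by (simp add: typing assoc)
  ultimately have "qle Q ((g \<cdot> f) \<cdot> (f' \<cdot> g')) (g \<cdot> g')" using comp_ident_left[OF G(1)] by simp
  then have 2: "qle Q ((g \<cdot> f) \<cdot> (f' \<cdot> g')) (Ident Q Z)"
    using qle_trans[OF _ G(3), of _ Z Z] O f(2) g(2) F(1) G(1) by (simp add: typing)
  show ?thesis
    using adjoint_pairI[OF _ _ 1 2] f(2) g(2) F(1) G(1) by (simp add: typing)
qed

lemma left_adjoint_comp: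
  "\<lbrakk>left_adjoint Q f; f \<in> hom Q X Y; left_adjoint Q g; g \<in> hom Q Y Z\<rbrakk> \<Longrightarrow> left_adjoint Q (g \<cdot> f)"
  using adjoint_comp[OF adjoint_right_adj _ adjoint_right_adj] unfolding left_adjoint_def by blast

section \<open>Gluing matching families of left adjoints\<close>

lemma hom_MapCat: "f \<in> hom (MapCat Q) X Y \<longleftrightarrow> f \<in> hom Q X Y \<and> left_adjoint Q f"
  by (auto simp: hom_def MapCat_def)

text \<open>The core of the gluing. Here \<open>s\<close> and \<open>t\<close> are members of a
  cover and \<open>x\<close> and \<open>z\<close> the values of a matching family at them. A
  pullback of \<open>s\<close> and \<open>t\<close> need not exist; the decomposition of
  \<open>s' t\<close> into pieces \<open>f g'\<close> takes its place, each piece giving a commuting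
  square to which \<open>agree\<close> applies.\<close>

lemma matching_family_bound:
  assumes md: "map_discrete Q" and wt: "weakly_tabular Q"
    and s: "s \<in> hom Q U X" "adjoint_pair Q s s'" and t: "t \<in> hom Q V X" "adjoint_pair Q t t'"
    and x: "x \<in> hom Q U Y" "left_adjoint Q x" and z: "z \<in> hom Q V Y" "adjoint_pair Q z z'"
    and agree: "\<And>W f g. \<lbrakk>f \<in> hom Q W U; left_adjoint Q f; g \<in> hom Q W V; left_adjoint Q g;
      s \<cdot> f = t \<cdot> g\<rbrakk> \<Longrightarrow> x \<cdot> f = z \<cdot> g"
  shows "qle Q (x \<cdot> (s' \<cdot> t)) z"
proof -
  note S = adjoint_pairD[OF s(2,1)] and T = adjoint_pairD[OF t(2,1)]
  have st: "s' \<cdot> t \<in> hom Q V U" using comp_in_hom[OF t(1) S(1)] .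
  obtain A where A: "A \<subseteq> map_spans Q V U" "s' \<cdot> t = hom_Sup Q V U A"
    using wt st unfolding weakly_tabular_def by blast
  note O = hom_Obj[OF s(1)] hom_Obj[OF t(1)] hom_Obj[OF x(1)]
  have Ah: "A \<subseteq> hom Q V U"
    using A(1) map_spans_hom by blast
  have "x \<cdot> (s' \<cdot> t) = hom_Sup Q V Y ((\<lambda>f. x \<cdot> f) ` A)"
    unfolding A(2) using comp_Sup_right[OF _ Ah x(1)] O by blast
  moreover have "qle Q (x \<cdot> a) z" if a: "a \<in> A" for a
  proof -
    obtain W f g g' where fg: "a = f \<cdot> g'" "f \<in> hom Q W U" "left_adjoint Q f"
      "g \<in> hom Q W V" "adjoint_pair Q g g'"
      using A(1) a unfolding map_spans_def by blast
    note G = adjoint_pairD[OF fg(5,4)]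
    note W = hom_Obj[OF fg(2)]
    have ah: "a \<in> hom Q V U" using a Ah by blast
    have le: "qle Q a (s' \<cdot> t)"
      unfolding A(2) using hom_order_lub(2)[OF _ Ah a] hom_complete[OF st] by blast
    \<comment> \<open>The unit of \<open>g\<close> gives \<open>f \<le> f g' g = a g\<close>, which
      trades the right adjoint \<open>g'\<close> for a composite with the map
      \<open>g\<close>.\<close>
    have "qle Q (f \<cdot> Ident Q W) (f \<cdot> (g' \<cdot> g))"
      using comp_mono_right[OF _ _ G(2) fg(2)] W G(1) fg(4) by (simp add: typing)
    then have 1: "qle Q f (a \<cdot> g)"
      unfolding fg(1) using comp_ident_right[OF fg(2)] comp_assoc[OF fg(4) G(1) fg(2)] by simp
    have 2: "qle Q (a \<cdot> g) ((s' \<cdot> t) \<cdot> g)"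
      using comp_mono_left[OF fg(4) ah st le] .
    have 3: "qle Q f ((s' \<cdot> t) \<cdot> g)"
      using qle_trans[OF 1 2 fg(2)] fg(4) ah st by (simp add: typing)
    have tg: "t \<cdot> g \<in> hom Q W X" using comp_in_hom[OF fg(4) t(1)] .
    have sf: "s \<cdot> f \<in> hom Q W X" using comp_in_hom[OF fg(2) s(1)] .
    \<comment> \<open>Composing \<open>f \<le> s' t g\<close> with \<open>s\<close> and cancelling
      \<open>s s'\<close> by the counit gives \<open>s f \<le> t g\<close>. Both sides are left
      adjoints, so discreteness makes this an equality.\<close>
    have "qle Q (s \<cdot> f) (s \<cdot> (s' \<cdot> t \<cdot> g))"
      using comp_mono_right[OF fg(2) comp_in_hom[OF fg(4) st] 3 s(1)] .
    also have "s \<cdot> (s' \<cdot> t \<cdot> g) = (s \<cdot> s') \<cdot> (t \<cdot> g)"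
      using comp_assoc[OF fg(4) t(1) S(1)] comp_assoc[OF tg S(1) s(1)] by simp
    finally have 4: "qle Q (s \<cdot> f) ((s \<cdot> s') \<cdot> (t \<cdot> g))" .
    have ss: "s \<cdot> s' \<in> hom Q X X" using comp_in_hom[OF S(1) s(1)] .
    have "qle Q ((s \<cdot> s') \<cdot> (t \<cdot> g)) (Ident Q X \<cdot> (t \<cdot> g))"
      using comp_mono_left[OF tg ss _ S(3)] ident_in_hom O by blast
    then have 5: "qle Q (s \<cdot> f) (t \<cdot> g)"
      using qle_trans[OF 4 _ sf _ tg] comp_in_hom[OF tg ss] comp_ident_left[OF tg] by simp
    have g: "left_adjoint Q g" "left_adjoint Q s" "left_adjoint Q t"
      using fg(5) s(2) t(2) unfolding left_adjoint_def by blast+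
    then have "s \<cdot> f = t \<cdot> g"
      using md 5 sf tg left_adjoint_comp[OF fg(3,2) g(2) s(1)] left_adjoint_comp[OF g(1) fg(4) g(3) t(1)]
      unfolding map_discrete_def by blast
    then have xz: "x \<cdot> f = z \<cdot> g" using agree[OF fg(2,3,4) g(1)] by blast
    have gg: "g \<cdot> g' \<in> hom Q V V" using comp_in_hom[OF G(1) fg(4)] .
    \<comment> \<open>Since \<open>x f = z g\<close>, the piece \<open>x f g'\<close> equals
      \<open>z g g'\<close>, and the counit of \<open>g\<close> bounds it by
      \<open>z\<close>.\<close>
    have "x \<cdot> a = z \<cdot> (g \<cdot> g')"
      unfolding fg(1) using comp_assoc[OF G(1) fg(2) x(1)] comp_assoc[OF G(1) fg(4) z(1)] xz by simp
    moreover have "qle Q (z \<cdot> (g \<cdot> g')) (z \<cdot> Ident Q V)"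
      using comp_mono_right[OF gg ident_in_hom G(3) z(1)] O by blast
    ultimately show ?thesis using comp_ident_right[OF z(1)] by simp
  qed
  ultimately show ?thesis
    using hom_order_lub(3)[OF hom_complete[OF z(1)] _ z(1), of "(\<lambda>f. x \<cdot> f) ` A"]
      comp_in_hom[OF _ x(1)] Ah by auto
qed

text \<open>Distributes over one supremum at a time. It serves for the counit of the glued arrow,
  where both factors are suprema.\<close>

lemma comp_Sup_Sup_le:
  assumes A: "A \<subseteq> hom Q X Y" and B: "B \<subseteq> hom Q Y Z" and O: "X \<in> Obj Q" "Y \<in> Obj Q" "Z \<in> Obj Q"
    and c: "c \<in> hom Q X Z" and le: "\<And>a b. a \<in> A \<Longrightarrow> b \<in> B \<Longrightarrow> qle Q (b \<cdot> a) c"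
  shows "qle Q (hom_Sup Q Y Z B \<cdot> hom_Sup Q X Y A) c"
proof -
  have SA: "hom_Sup Q X Y A \<in> hom Q X Y" using hom_order_lub(1)[OF complete[OF O(1,2)] A] .
  have "qle Q (b \<cdot> hom_Sup Q X Y A) c" if b: "b \<in> B" for b
  proof -
    have "b \<cdot> hom_Sup Q X Y A = hom_Sup Q X Z ((\<lambda>f. b \<cdot> f) ` A)"
      using comp_Sup_right[OF O(1) A, of b Z] B b by blast
    moreover have bA: "(\<lambda>f. b \<cdot> f) ` A \<subseteq> hom Q X Z" using comp_in_hom[of _ X Y b Z] A B b by blast
    ultimately show ?thesis
      using hom_order_lub(3)[OF complete[OF O(1,3)] bA c] le b by auto
  qed
  moreover have "hom_Sup Q Y Z B \<cdot> hom_Sup Q X Y A = hom_Sup Q X Z ((\<lambda>g. g \<cdot> hom_Sup Q X Y A) ` B)"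
    using comp_Sup_left[OF O(3) SA B] .
  ultimately show ?thesis
    using hom_order_lub(3)[OF complete[OF O(1,3)] _ c, of "(\<lambda>g. g \<cdot> hom_Sup Q X Y A) ` B"] B
      comp_in_hom[OF SA] by auto
qed

lemma map_gluing:
  assumes md: "map_discrete Q" and wt: "weakly_tabular Q" and X: "X \<in> Obj Q" and Y: "Y \<in> Obj Q"
    and S: "\<And>s. s \<in> S \<Longrightarrow> s \<in> hom Q (Dom Q s) X" "\<And>s. s \<in> S \<Longrightarrow> left_adjoint Q s"
    and cover: "Ident Q X = hom_Sup Q X X ((\<lambda>s. s \<cdot> right_adj Q s) ` S)"
    and x: "\<And>s. s \<in> S \<Longrightarrow> x s \<in> hom Q (Dom Q s) Y" "\<And>s. s \<in> S \<Longrightarrow> left_adjoint Q (x s)"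
    and agree: "\<And>s t W f g. \<lbrakk>s \<in> S; t \<in> S; f \<in> hom Q W (Dom Q s); left_adjoint Q f;
      g \<in> hom Q W (Dom Q t); left_adjoint Q g; s \<cdot> f = t \<cdot> g\<rbrakk> \<Longrightarrow> x s \<cdot> f = x t \<cdot> g"
  shows "\<exists>!y. (y \<in> hom Q X Y \<and> left_adjoint Q y) \<and> (\<forall>s\<in>S. y \<cdot> s = x s)"
proof -
  define s' where "s' = right_adj Q"
  define x' where "x' = (\<lambda>s. right_adj Q (x s))"
  have adj: "adjoint_pair Q s (s' s)" "adjoint_pair Q (x s) (x' s)" if "s \<in> S" for s
    using adjoint_right_adj S(2) x(2) that unfolding s'_def x'_def by blast+
  note sD = adjoint_pairD[OF adj(1) S(1)] and xD = adjoint_pairD[OF adj(2) x(1)]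
  have bound: "qle Q (x s \<cdot> (s' s \<cdot> t)) (x t)" if "s \<in> S" "t \<in> S" for s t
    using matching_family_bound[OF md wt S(1)[OF that(1)] adj(1)[OF that(1)] S(1)[OF that(2)] adj(1)[OF that(2)]
      x(1)[OF that(1)] x(2)[OF that(1)] x(1)[OF that(2)] adj(2)[OF that(2)]] agree[OF that] by blast
  have DO: "Dom Q s \<in> Obj Q" if "s \<in> S" for s using hom_Obj S(1) that by blast
  define B where "B = (\<lambda>s. x s \<cdot> s' s) ` S"
  define B' where "B' = (\<lambda>s. s \<cdot> x' s) ` S"
  define y where "y = hom_Sup Q X Y B"
  define y' where "y' = hom_Sup Q Y X B'"
  have B: "B \<subseteq> hom Q X Y" and B': "B' \<subseteq> hom Q Y X"
    unfolding B_def B'_def using comp_in_hom[OF sD(1) x(1)] comp_in_hom[OF xD(1) S(1)] by blast+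
  have yh: "y \<in> hom Q X Y" and y'h: "y' \<in> hom Q Y X"
    unfolding y_def y'_def using hom_order_lub(1)[OF complete] X Y B B' by blast+
  have ss: "s \<cdot> s' s \<in> hom Q X X" if "s \<in> S" for s using comp_in_hom[OF sD(1) S(1)] that by blast
  have unit: "qle Q (s \<cdot> s' s) (y' \<cdot> y)" if s: "s \<in> S" for s
  proof -
    have a: "x s \<cdot> s' s \<in> B" "s \<cdot> x' s \<in> B'" using s B_def B'_def by blast+
    have b: "x s \<cdot> s' s \<in> hom Q X Y" "s \<cdot> x' s \<in> hom Q Y X" using a B B' by blast+
    have xx: "x' s \<cdot> x s \<in> hom Q (Dom Q s) (Dom Q s)" using s comp_in_hom[OF x(1) xD(1)] by blast
    have i: "Ident Q (Dom Q s) \<in> hom Q (Dom Q s) (Dom Q s)" using ident_in_hom[OF DO[OF s]] .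
    \<comment> \<open>The unit of \<open>x s\<close> is inserted between \<open>s\<close> and
      \<open>s' s\<close>, so that \<open>s s'\<close> lies below the product of the members of
      \<open>B'\<close> and \<open>B\<close> indexed by the same \<open>s\<close>.\<close>
    have "qle Q (Ident Q (Dom Q s) \<cdot> s' s) ((x' s \<cdot> x s) \<cdot> s' s)"
      using comp_mono_left[OF sD(1)[OF s s] i xx xD(2)[OF s s]] .
    then have 1: "qle Q (s' s) ((x' s \<cdot> x s) \<cdot> s' s)" using comp_ident_left[OF sD(1)[OF s s]] by simp
    have "qle Q (s \<cdot> s' s) (s \<cdot> ((x' s \<cdot> x s) \<cdot> s' s))"
      using comp_mono_right[OF sD(1)[OF s s] _ 1 S(1)[OF s]] comp_in_hom[OF sD(1)[OF s s] xx] by blast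
    also have "s \<cdot> ((x' s \<cdot> x s) \<cdot> s' s) = (s \<cdot> x' s) \<cdot> (x s \<cdot> s' s)"
      using comp_assoc[OF sD(1)[OF s s] x(1)[OF s] xD(1)[OF s s]]
        comp_assoc[OF b(1) xD(1)[OF s s] S(1)[OF s]] by simp
    finally have 2: "qle Q (s \<cdot> s' s) ((s \<cdot> x' s) \<cdot> (x s \<cdot> s' s))" .
    have l: "qle Q (x s \<cdot> s' s) y" "qle Q (s \<cdot> x' s) y'"
      unfolding y_def y'_def using hom_order_lub(2)[OF complete] X Y B B' a by blast+
    have 3: "qle Q ((s \<cdot> x' s) \<cdot> (x s \<cdot> s' s)) ((s \<cdot> x' s) \<cdot> y)"
      using comp_mono_right[OF b(1) yh l(1) b(2)] .
    have 4: "qle Q ((s \<cdot> x' s) \<cdot> y) (y' \<cdot> y)"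
      using comp_mono_left[OF yh b(2) y'h l(2)] .
    show ?thesis
      using qle_trans[OF qle_trans[OF 2 3] 4, of X X X X] b yh y'h ss[OF s] by (simp add: typing)
  qed
  \<comment> \<open>By the covering condition the identity is the supremum of the arrows
    \<open>s s'\<close>, so the unit inequality can be checked on each of them.\<close>
  have "qle Q (Ident Q X) (y' \<cdot> y)"
    unfolding cover using hom_order_lub(3)[OF complete[OF X X] _ comp_in_hom[OF yh y'h],
        of "(\<lambda>s. s \<cdot> right_adj Q s) ` S"] unit ss
    unfolding s'_def by blast
  moreover have "qle Q (y \<cdot> y') (Ident Q Y)"
    unfolding y_def y'_def
  proof (rule comp_Sup_Sup_le[OF B' B Y X Y])
    show "Ident Q Y \<in> hom Q Y Y" using ident_in_hom Y by blast
    fix a b assume "a \<in> B'" "b \<in> B"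
    then obtain s t where st: "s \<in> S" "t \<in> S" "a = t \<cdot> x' t" "b = x s \<cdot> s' s"
      unfolding B_def B'_def by blast
    have h: "s' s \<cdot> t \<in> hom Q (Dom Q t) (Dom Q s)" using comp_in_hom[OF S(1) sD(1)] st by blast
    \<comment> \<open>Regrouping isolates \<open>x s (s' s t)\<close>, which \<open>bound\<close>
      replaces by \<open>x t\<close>. What remains is \<open>x t\<close> composed with its right
      adjoint, below the identity by the counit.\<close>
    have "b \<cdot> a = x s \<cdot> (s' s \<cdot> (t \<cdot> x' t))"
      unfolding st(3,4) using S(1)[OF st(2)] sD(1)[OF st(1,1)] xD(1)[OF st(2,2)] x(1)[OF st(1)] by (simp add: typing assoc)
    also have "\<dots> = (x s \<cdot> (s' s \<cdot> t)) \<cdot> x' t"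
      using S(1)[OF st(2)] sD(1)[OF st(1,1)] xD(1)[OF st(2,2)] x(1)[OF st(1)] by (simp add: typing assoc)
    finally have e: "b \<cdot> a = (x s \<cdot> (s' s \<cdot> t)) \<cdot> x' t" .
    have h2: "x s \<cdot> (s' s \<cdot> t) \<in> hom Q (Dom Q t) Y" using comp_in_hom[OF h x(1)] st by blast
    have "qle Q (b \<cdot> a) (x t \<cdot> x' t)"
      unfolding e using comp_mono_left[OF xD(1) h2 x(1) bound] st by blast
    then show "qle Q (b \<cdot> a) (Ident Q Y)"
      using qle_trans[OF _ xD(3)[OF st(2,2)], of "b \<cdot> a" Y Y] x(1)[OF st(2)] xD(1)[OF st(2,2)] h2 Y
      unfolding e by (simp add: typing)
  qed
  ultimately have ymap: "left_adjoint Q y" using adjoint_pairI[OF yh y'h] unfolding left_adjoint_def by blast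
  have yt: "y \<cdot> t = x t" if t: "t \<in> S" for t
  proof -
    \<comment> \<open>Only \<open>y t \<le> x t\<close> is derived from the supremum. Equality
      follows because both sides are left adjoints and \<open>Q\<close> is map-discrete.\<close>
    have "y \<cdot> t = hom_Sup Q (Dom Q t) Y ((\<lambda>g. g \<cdot> t) ` B)"
      unfolding y_def using comp_Sup_left[OF Y S(1)[OF t] B] .
    moreover have "qle Q (g \<cdot> t) (x t)" if g: "g \<in> B" for g
    proof -
      obtain s where s: "s \<in> S" "g = x s \<cdot> s' s" using g B_def by blast
      then have "g \<cdot> t = x s \<cdot> (s' s \<cdot> t)" using comp_assoc[OF S(1)[OF t] sD(1) x(1)] by simp
      then show ?thesis using bound s t by simp
    qed
    ultimately have "qle Q (y \<cdot> t) (x t)"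
      using hom_order_lub(3)[OF complete[OF DO[OF t] Y] _ x(1)[OF t], of "(\<lambda>g. g \<cdot> t) ` B"] B
        comp_in_hom[OF S(1)[OF t]] by auto
    moreover have "y \<cdot> t \<in> hom Q (Dom Q t) Y" using comp_in_hom[OF S(1)[OF t] yh] .
    moreover have "left_adjoint Q (y \<cdot> t)" using left_adjoint_comp[OF S(2,1)[OF t] ymap yh] .
    ultimately show ?thesis using md x(1,2)[OF t] unfolding map_discrete_def by blast
  qed
  show ?thesis
  proof (rule ex1I[of _ y])
    show "(y \<in> hom Q X Y \<and> left_adjoint Q y) \<and> (\<forall>s\<in>S. y \<cdot> s = x s)" using yh ymap yt by blast
    fix z assume z: "(z \<in> hom Q X Y \<and> left_adjoint Q z) \<and> (\<forall>s\<in>S. z \<cdot> s = x s)"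
    then have zh: "z \<in> hom Q X Y" by blast
    \<comment> \<open>Uniqueness: expanding the identity by the covering condition gives
      \<open>z\<close> as the supremum of \<open>z s s' = x s s'\<close>, which is
      \<open>y\<close>.\<close>
    have "z = z \<cdot> Ident Q X" using comp_ident_right zh by simp
    also have "\<dots> = hom_Sup Q X Y ((\<lambda>f. z \<cdot> f) ` ((\<lambda>s. s \<cdot> s' s) ` S))"
      unfolding cover s'_def using comp_Sup_right[OF X _ zh, of "(\<lambda>s. s \<cdot> right_adj Q s) ` S"] ss
      unfolding s'_def by blast
    also have "(\<lambda>f. z \<cdot> f) ` ((\<lambda>s. s \<cdot> s' s) ` S) = B"
      unfolding B_def image_image
    proof (rule image_cong)
      fix s assume s: "s \<in> S"
      show "z \<cdot> (s \<cdot> s' s) = x s \<cdot> s' s" using comp_assoc[OF sD(1)[OF s s] S(1)[OF s] zh] z s by simp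
    qed simp
    finally show "z = y" by (simp add: y_def)
  qed
qed

lemma representable_presheaf: "is_presheaf (MapCat Q) (representable (MapCat Q) Y)"
proof -
  have arr: "f \<in> Arr (MapCat Q) \<longleftrightarrow> f \<in> hom (MapCat Q) (Dom Q f) (Cod Q f)" for f
    by (auto simp: hom_def MapCat_def)
  have [simp]: "Dom (MapCat Q) = Dom Q" "Cod (MapCat Q) = Cod Q" "Comp (MapCat Q) = Comp Q"
    "Obj (MapCat Q) = Obj Q" "Ident (MapCat Q) = Ident Q" by (simp_all add: MapCat_def)
  show ?thesis
    unfolding is_presheaf_def representable_def
    by (auto simp: arr hom_MapCat comp_ident_right comp_in_hom left_adjoint_comp)
      (simp add: typing assoc)
qed

lemma subcanonical_map_topology:
  assumes md: "map_discrete Q" and wt: "weakly_tabular Q"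
  shows "subcanonical (MapCat Q) (map_topology Q)"
  unfolding subcanonical_def is_sheaf_def
proof (intro ballI conjI allI impI)
  fix Y X S x
  assume Y: "Y \<in> Obj (MapCat Q)" and X: "X \<in> Obj (MapCat Q)" and S: "S \<in> map_topology Q X"
    and x: "matching_family (MapCat Q) (representable (MapCat Q) Y) S x"
  have simps [simp]: "Dom (MapCat Q) = Dom Q" "Cod (MapCat Q) = Cod Q" "Comp (MapCat Q) = Comp Q"
    "Obj (MapCat Q) = Obj Q" by (simp_all add: MapCat_def)
  have XY: "X \<in> Obj Q" "Y \<in> Obj Q" using X Y by simp_all
  have SS: "sieve (MapCat Q) X S" "Ident Q X = hom_Sup Q X X ((\<lambda>s. s \<cdot> right_adj Q s) ` S)"
    using S unfolding map_topology_def by blast+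
  have S1: "s \<in> hom Q (Dom Q s) X" "left_adjoint Q s" if "s \<in> S" for s
    using SS(1) that by (auto simp: sieve_def MapCat_def hom_def)
  have x1: "x s \<in> hom Q (Dom Q s) Y" "left_adjoint Q (x s)" if "s \<in> S" for s
    using x that by (auto simp: matching_family_def representable_def hom_MapCat)
  have x2: "x (s \<cdot> h) = x s \<cdot> h" if "s \<in> S" "h \<in> hom Q W (Dom Q s)" "left_adjoint Q h" for s h W
    using x that by (auto simp: matching_family_def representable_def MapCat_def hom_def)
  \<comment> \<open>Both sides are the value of \<open>x\<close> at the common composite
    \<open>s f = t g\<close>, which turns compatibility on the sieve into agreement on commuting
    squares.\<close>
  have "x s \<cdot> f = x t \<cdot> g" if "s \<in> S" "t \<in> S" "f \<in> hom Q W (Dom Q s)" "left_adjoint Q f"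
      "g \<in> hom Q W (Dom Q t)" "left_adjoint Q g" "s \<cdot> f = t \<cdot> g" for s t W f g
    using x2[of s f W] x2[of t g W] that by simp
  then have "\<exists>!y. (y \<in> hom Q X Y \<and> left_adjoint Q y) \<and> (\<forall>s\<in>S. y \<cdot> s = x s)"
    using map_gluing[OF md wt XY S1 SS(2) x1] by blast
  then show "\<exists>!y. y \<in> sec (representable (MapCat Q) Y) X \<and>
      (\<forall>s\<in>S. res (representable (MapCat Q) Y) s y = x s)"
    by (simp add: representable_def hom_MapCat)
qed (rule representable_presheaf)

end

section \<open>Local equality and closed cribles\<close>

context site
begin

text \<open>Read as: \<open>P\<close> holds locally on \<open>U\<close>. The quantifiers are those
  of \<open>crible_closure\<close>, and \<open>P\<close> is an arbitrary predicate, so that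
  conditions on composites can be expressed directly.\<close>

definition covers :: "'o \<Rightarrow> ('a \<Rightarrow> bool) \<Rightarrow> bool" where
  "covers U P \<longleftrightarrow> (\<exists>S \<in> J U. \<forall>s \<in> S. P s)"

lemma topologyD:
  assumes "U \<in> Obj C"
  shows "S \<in> J U \<Longrightarrow> sieve C U S"
    and "{f \<in> Arr C. Cod C f = U} \<in> J U"
    and "\<lbrakk>S \<in> J U; h \<in> Arr C; Cod C h = U\<rbrakk> \<Longrightarrow> pullback_sieve C h S \<in> J (Dom C h)"
    and "\<lbrakk>S \<in> J U; sieve C U T; \<And>s. s \<in> S \<Longrightarrow> pullback_sieve C s T \<in> J (Dom C s)\<rbrakk> \<Longrightarrow> T \<in> J U"
proof -
  note T = topology[unfolded grothendieck_topology_def]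
  show "S \<in> J U \<Longrightarrow> sieve C U S" using T assms by blast
  show "{f \<in> Arr C. Cod C f = U} \<in> J U" using T assms by blast
  show "\<lbrakk>S \<in> J U; h \<in> Arr C; Cod C h = U\<rbrakk> \<Longrightarrow> pullback_sieve C h S \<in> J (Dom C h)"
    using T[THEN conjunct2, THEN conjunct2, THEN conjunct1] assms by simp
  show "\<lbrakk>S \<in> J U; sieve C U T; \<And>s. s \<in> S \<Longrightarrow> pullback_sieve C s T \<in> J (Dom C s)\<rbrakk> \<Longrightarrow> T \<in> J U"
    using T[THEN conjunct2, THEN conjunct2, THEN conjunct2] assms by simp
qed

lemma covers_maximal: "\<lbrakk>U \<in> Obj C; \<And>s. \<lbrakk>s \<in> Arr C; Cod C s = U\<rbrakk> \<Longrightarrow> P s\<rbrakk> \<Longrightarrow> covers U P"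
  unfolding covers_def by (rule bexI[OF _ topologyD(2)]) auto

lemma covers_pullback:
  assumes "covers (Cod C h) P" "h \<in> Arr C"
  shows "covers (Dom C h) (\<lambda>s. P (h \<cdot> s))"
proof -
  obtain S where S: "S \<in> J (Cod C h)" "\<And>s. s \<in> S \<Longrightarrow> P s" using assms(1) by (auto simp: covers_def)
  have "pullback_sieve C h S \<in> J (Dom C h)"
    using topologyD(3)[OF cod_in_Obj[OF assms(2)] S(1) assms(2)] by simp
  then show ?thesis unfolding covers_def using S(2) by (auto simp: pullback_sieve_def intro!: bexI[rotated])
qed

text \<open>Pulled back along a member of \<open>S\<close>, the larger sieve \<open>T\<close>
  becomes maximal, so the transitivity axiom applies.\<close>

lemma sieve_superset:
  assumes U: "U \<in> Obj C" and S: "S \<in> J U" and T: "sieve C U T" "S \<subseteq> T"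
  shows "T \<in> J U"
proof (rule topologyD(4)[OF U S T(1)])
  fix s assume s: "s \<in> S"
  have sA: "s \<in> Arr C" "Cod C s = U" "s \<in> T" using topologyD(1)[OF U S] s T(2) by (auto simp: sieve_def)
  then have "pullback_sieve C s T = {f \<in> Arr C. Cod C f = Dom C s}"
    using T(1) by (auto simp: pullback_sieve_def sieve_def)
  then show "pullback_sieve C s T \<in> J (Dom C s)"
    using topologyD(2)[OF dom_in_Obj[OF sA(1)]] by simp
qed

text \<open>Local truth is itself local; this carries the transitivity axiom from sieves to
  arbitrary predicates.\<close>

lemma covers_trans:
  assumes U: "U \<in> Obj C" and P: "covers U P"
    and R: "\<And>s. \<lbrakk>s \<in> Arr C; Cod C s = U; P s\<rbrakk> \<Longrightarrow> covers (Dom C s) (\<lambda>h. R (s \<cdot> h))"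
  shows "covers U R"
proof -
  obtain S where S: "S \<in> J U" "\<And>s. s \<in> S \<Longrightarrow> P s" using P by (auto simp: covers_def)
  \<comment> \<open>Since \<open>R\<close> is not assumed stable under precomposition,
    \<open>T\<close> is taken as the largest sieve on \<open>U\<close> all of whose members satisfy
    \<open>R\<close>.\<close>
  define T where "T = {f \<in> Arr C. Cod C f = U \<and> (\<forall>h \<in> Arr C. Cod C h = Dom C f \<longrightarrow> R (f \<cdot> h))}"
  have T: "sieve C U T"
    unfolding sieve_def T_def using U by (auto simp: typing assoc)
  have "T \<in> J U"
  proof (rule topologyD(4)[OF U S(1) T])
    fix s assume s: "s \<in> S"
    have sA: "s \<in> Arr C" "Cod C s = U" using topologyD(1)[OF U S(1)] s by (auto simp: sieve_def)
    have O: "Dom C s \<in> Obj C" using dom_in_Obj sA by blast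
    obtain S' where S': "S' \<in> J (Dom C s)" "\<And>h. h \<in> S' \<Longrightarrow> R (s \<cdot> h)"
      using R[OF sA S(2)[OF s]] by (auto simp: covers_def)
    have sv: "sieve C (Dom C s) S'" using topologyD(1)[OF O S'(1)] .
    show "pullback_sieve C s T \<in> J (Dom C s)"
    proof (rule sieve_superset[OF O S'(1)])
      show "sieve C (Dom C s) (pullback_sieve C s T)"
        using T O sA unfolding sieve_def pullback_sieve_def by (auto simp: typing assoc[symmetric])
      show "S' \<subseteq> pullback_sieve C s T"
      proof
        fix h assume h: "h \<in> S'"
        have hA: "h \<in> Arr C" "Cod C h = Dom C s" using sv h by (auto simp: sieve_def)
        have "R (s \<cdot> h \<cdot> k)" if "k \<in> Arr C" "Cod C k = Dom C h" for k
        proof -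
          have "h \<cdot> k \<in> S'" using sv h that unfolding sieve_def by blast
          then show ?thesis using S'(2) assoc sA hA that by simp
        qed
        then show "h \<in> pullback_sieve C s T"
          unfolding pullback_sieve_def T_def using hA sA by (simp add: typing)
      qed
    qed
  qed
  moreover have "R f" if "f \<in> T" for f
  proof -
    have f: "f \<in> Arr C" "\<And>h. \<lbrakk>h \<in> Arr C; Cod C h = Dom C f\<rbrakk> \<Longrightarrow> R (f \<cdot> h)"
      using that by (auto simp: T_def)
    have "R (f \<cdot> Ident C (Dom C f))" using f dom_in_Obj[OF f(1)] by (simp add: typing)
    then show ?thesis using comp_ident_right[of f "Dom C f" "Cod C f"] f(1) by (simp add: hom_def)
  qed
  ultimately show ?thesis unfolding covers_def by blast
qed

lemma covers_mono:
  assumes "U \<in> Obj C" "covers U P" "\<And>s. \<lbrakk>s \<in> Arr C; Cod C s = U; P s\<rbrakk> \<Longrightarrow> R s"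
  shows "covers U R"
proof -
  obtain S where S: "S \<in> J U" "\<forall>s \<in> S. P s" using assms(2) by (auto simp: covers_def)
  have "\<forall>s \<in> S. R s" using S(2) assms(3) topologyD(1)[OF assms(1) S(1)] by (auto simp: sieve_def)
  then show ?thesis using S(1) by (auto simp: covers_def)
qed

text \<open>The cover for \<open>R\<close> is pulled back along each \<open>s\<close> with
  \<open>P s\<close>; the hypothesis \<open>stable\<close> then carries \<open>P\<close> from
  \<open>s\<close> to \<open>s h\<close>.\<close>

lemma covers_conj:
  assumes U: "U \<in> Obj C" and P: "covers U P" and R: "covers U R"
    and stable: "\<And>s h. \<lbrakk>s \<in> Arr C; Cod C s = U; h \<in> Arr C; Cod C h = Dom C s; P s\<rbrakk> \<Longrightarrow> P (s \<cdot> h)"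
  shows "covers U (\<lambda>s. P s \<and> R s)"
proof (rule covers_trans[OF U P])
  fix s assume s: "s \<in> Arr C" "Cod C s = U" "P s"
  have "covers (Dom C s) (\<lambda>h. R (s \<cdot> h))" using covers_pullback[of s R] R s by simp
  then show "covers (Dom C s) (\<lambda>h. P (s \<cdot> h) \<and> R (s \<cdot> h))"
    by (rule covers_mono[OF dom_in_Obj[OF s(1)]]) (use stable s in blast)
qed

text \<open>Parallel arrows are locally equal when they become equal in the sheafification of the
  presheaf represented by their codomain. The topology on \<open>C\<close> is arbitrary, so distinct
  arrows can be locally equal.\<close>

definition locally_equal :: "'a \<Rightarrow> 'a \<Rightarrow> bool" where
  "locally_equal f g \<longleftrightarrow> f \<in> Arr C \<and> g \<in> Arr C \<and> Dom C f = Dom C g \<and> Cod C f = Cod C g \<and>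
     covers (Dom C f) (\<lambda>s. f \<cdot> s = g \<cdot> s)"

lemma locally_equal_refl: "f \<in> Arr C \<Longrightarrow> locally_equal f f"
  unfolding locally_equal_def by (simp add: covers_maximal dom_in_Obj)

lemma locally_equal_sym: "locally_equal f g \<Longrightarrow> locally_equal g f"
  by (auto simp: locally_equal_def eq_commute[of "g \<cdot> s" "f \<cdot> s" for s])

lemma locally_equal_trans:
  assumes "locally_equal f g" "locally_equal g h" shows "locally_equal f h"
proof -
  have A: "f \<in> Arr C" "g \<in> Arr C" "h \<in> Arr C" "Dom C f = Dom C g" "Dom C g = Dom C h"
    "Cod C f = Cod C g" "Cod C g = Cod C h"
    "covers (Dom C f) (\<lambda>s. f \<cdot> s = g \<cdot> s)" "covers (Dom C f) (\<lambda>s. g \<cdot> s = h \<cdot> s)"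
    using assms by (auto simp: locally_equal_def)
  have O: "Dom C f \<in> Obj C" using dom_in_Obj[OF A(1)] .
  have "covers (Dom C f) (\<lambda>s. f \<cdot> s = g \<cdot> s \<and> g \<cdot> s = h \<cdot> s)"
  proof (rule covers_conj[OF O A(8,9)])
    fix s k assume "s \<in> Arr C" "Cod C s = Dom C f" "k \<in> Arr C" "Cod C k = Dom C s" "f \<cdot> s = g \<cdot> s"
    then show "f \<cdot> (s \<cdot> k) = g \<cdot> (s \<cdot> k)"
      using A(1-4) assoc[of k s f] assoc[of k s g] by simp
  qed
  then show ?thesis
    using covers_mono[OF O, of _ "\<lambda>s. f \<cdot> s = h \<cdot> s"] A(1-7) unfolding locally_equal_def by simp
qed

lemma locally_equal_precomp:
  assumes "locally_equal f g" "h \<in> Arr C" "Cod C h = Dom C f"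
  shows "locally_equal (f \<cdot> h) (g \<cdot> h)"
proof -
  have "covers (Dom C h) (\<lambda>s. f \<cdot> (h \<cdot> s) = g \<cdot> (h \<cdot> s))"
    using covers_pullback[of h "\<lambda>s. f \<cdot> s = g \<cdot> s"] assms by (auto simp: locally_equal_def)
  then have "covers (Dom C h) (\<lambda>s. f \<cdot> h \<cdot> s = g \<cdot> h \<cdot> s)"
    by (rule covers_mono[OF dom_in_Obj[OF assms(2)]])
      (use assms in \<open>simp add: assoc locally_equal_def\<close>)
  then show ?thesis using assms by (simp add: locally_equal_def typing)
qed

text \<open>A cover of covers is a cover, so equality after two successive restrictions is again
  local equality.\<close>

lemma locally_equal_local:
  assumes "f \<in> Arr C" "g \<in> Arr C" "Dom C f = Dom C g" "Cod C f = Cod C g"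
    and "covers (Dom C f) (\<lambda>s. locally_equal (f \<cdot> s) (g \<cdot> s))"
  shows "locally_equal f g"
proof -
  have O: "Dom C f \<in> Obj C" using dom_in_Obj[OF assms(1)] .
  have "covers (Dom C f) (\<lambda>s. f \<cdot> s = g \<cdot> s)"
  proof (rule covers_trans[OF O assms(5)])
    fix s assume s: "s \<in> Arr C" "Cod C s = Dom C f" "locally_equal (f \<cdot> s) (g \<cdot> s)"
    then have "covers (Dom C s) (\<lambda>h. f \<cdot> s \<cdot> h = g \<cdot> s \<cdot> h)"
      using assms by (simp add: locally_equal_def typing)
    then show "covers (Dom C s) (\<lambda>h. f \<cdot> (s \<cdot> h) = g \<cdot> (s \<cdot> h))"
      by (rule covers_mono[OF dom_in_Obj[OF s(1)]]) (use assms s in \<open>simp add: assoc\<close>)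
  qed
  then show ?thesis using assms by (simp add: locally_equal_def)
qed

section \<open>Closed cribles and the closure operator\<close>

definition closed_crible :: "'o \<Rightarrow> 'o \<Rightarrow> ('a \<times> 'a) set \<Rightarrow> bool" where
  "closed_crible X Y R \<longleftrightarrow> X \<in> Obj C \<and> Y \<in> Obj C \<and> crible C X Y R \<and> crible_closure C J X Y R = R"

lemma mem_closure:
  "(f, g) \<in> crible_closure C J X Y R \<longleftrightarrow>
     (f, g) \<in> spans C X Y \<and> covers (Dom C f) (\<lambda>s. (f \<cdot> s, g \<cdot> s) \<in> R)"
  by (auto simp: crible_closure_def covers_def)

lemma mem_spans:
  "(f, g) \<in> spans C X Y \<longleftrightarrow>
     f \<in> Arr C \<and> g \<in> Arr C \<and> Dom C f = Dom C g \<and> Cod C f = Y \<and> Cod C g = X"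
  by (simp add: spans_def)

lemma cribleI:
  assumes "\<And>f g. (f, g) \<in> R \<Longrightarrow> (f, g) \<in> spans C X Y"
    and "\<And>f g h. \<lbrakk>(f, g) \<in> R; h \<in> Arr C; Cod C h = Dom C f\<rbrakk> \<Longrightarrow> (f \<cdot> h, g \<cdot> h) \<in> R"
  shows "crible C X Y R"
  using assms unfolding crible_def by auto

lemma crible_precomp:
  "\<lbrakk>crible C X Y R; (f, g) \<in> R; h \<in> Arr C; Cod C h = Dom C f\<rbrakk> \<Longrightarrow> (f \<cdot> h, g \<cdot> h) \<in> R"
  unfolding crible_def by blast

lemma crible_spans: "\<lbrakk>crible C X Y R; (f, g) \<in> R\<rbrakk> \<Longrightarrow> (f, g) \<in> spans C X Y"
  unfolding crible_def by blast

lemma crible_le_closure: "crible C X Y R \<Longrightarrow> R \<subseteq> crible_closure C J X Y R"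
proof clarify
  fix f g assume R: "crible C X Y R" and fg: "(f, g) \<in> R"
  have "(f, g) \<in> spans C X Y" using crible_spans[OF R fg] .
  moreover from this have "covers (Dom C f) (\<lambda>s. (f \<cdot> s, g \<cdot> s) \<in> R)"
    using covers_maximal[OF dom_in_Obj[of f] crible_precomp[OF R fg]] by (simp add: mem_spans)
  ultimately show "(f, g) \<in> crible_closure C J X Y R" by (simp add: mem_closure)
qed

text \<open>A crible always lies inside its closure, so closedness amounts to the other
  inclusion.\<close>

lemma closed_cribleI:
  assumes "X \<in> Obj C" "Y \<in> Obj C" "crible C X Y R"
    and "\<And>f g. \<lbrakk>(f, g) \<in> spans C X Y; covers (Dom C f) (\<lambda>s. (f \<cdot> s, g \<cdot> s) \<in> R)\<rbrakk> \<Longrightarrow> (f, g) \<in> R"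
  shows "closed_crible X Y R"
  using assms crible_le_closure[OF assms(3)] by (auto simp: closed_crible_def mem_closure)

lemma closed_cribleD:
  "\<lbrakk>closed_crible X Y R; (f, g) \<in> spans C X Y; covers (Dom C f) (\<lambda>s. (f \<cdot> s, g \<cdot> s) \<in> R)\<rbrakk> \<Longrightarrow> (f, g) \<in> R"
  using mem_closure[of f g X Y R] by (simp add: closed_crible_def)

lemma closed_crible_crible: "closed_crible X Y R \<Longrightarrow> crible C X Y R"
  by (simp add: closed_crible_def)

lemma closure_mono:
  assumes "R \<subseteq> S" shows "crible_closure C J X Y R \<subseteq> crible_closure C J X Y S"
  using assms unfolding crible_closure_def by blast

lemma closure_least: "\<lbrakk>closed_crible X Y S; R \<subseteq> S\<rbrakk> \<Longrightarrow> crible_closure C J X Y R \<subseteq> S"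
  using closure_mono[of R S X Y] by (simp add: closed_crible_def)

text \<open>Stability of covers under pullback makes the closure a crible, and their transitivity
  makes closing idempotent.\<close>

lemma closure_closed:
  assumes "X \<in> Obj C" "Y \<in> Obj C" "crible C X Y R"
  shows "closed_crible X Y (crible_closure C J X Y R)"
proof (rule closed_cribleI[OF assms(1,2)])
  show "crible C X Y (crible_closure C J X Y R)"
    unfolding crible_def
  proof (intro conjI subsetI ballI impI; clarify)
    fix f g assume "(f, g) \<in> crible_closure C J X Y R"
    then show "(f, g) \<in> spans C X Y" by (simp add: mem_closure)
  next
    fix f g h assume fg: "(f, g) \<in> crible_closure C J X Y R" and h: "h \<in> Arr C" "Cod C h = Dom C f"
    have A: "f \<in> Arr C" "g \<in> Arr C" "Dom C f = Dom C g" "Cod C f = Y" "Cod C g = X"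
      "covers (Dom C f) (\<lambda>s. (f \<cdot> s, g \<cdot> s) \<in> R)"
      using fg by (auto simp: mem_closure mem_spans)
    have "covers (Dom C h) (\<lambda>s. (f \<cdot> (h \<cdot> s), g \<cdot> (h \<cdot> s)) \<in> R)"
      using covers_pullback[of h "\<lambda>s. (f \<cdot> s, g \<cdot> s) \<in> R"] A h by simp
    then have "covers (Dom C h) (\<lambda>s. (f \<cdot> h \<cdot> s, g \<cdot> h \<cdot> s) \<in> R)"
      by (rule covers_mono[OF dom_in_Obj[OF h(1)]]) (use A h in \<open>simp add: assoc\<close>)
    then show "(f \<cdot> h, g \<cdot> h) \<in> crible_closure C J X Y R"
      using A h by (simp add: mem_closure mem_spans typing)
  qed
next
  fix f g assume fg: "(f, g) \<in> spans C X Y"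
    and cov: "covers (Dom C f) (\<lambda>s. (f \<cdot> s, g \<cdot> s) \<in> crible_closure C J X Y R)"
  have A: "f \<in> Arr C" "g \<in> Arr C" "Dom C f = Dom C g" using fg by (auto simp: mem_spans)
  have "covers (Dom C f) (\<lambda>s. (f \<cdot> s, g \<cdot> s) \<in> R)"
  proof (rule covers_trans[OF dom_in_Obj[OF A(1)] cov])
    fix s assume s: "s \<in> Arr C" "Cod C s = Dom C f" "(f \<cdot> s, g \<cdot> s) \<in> crible_closure C J X Y R"
    then have "covers (Dom C s) (\<lambda>h. (f \<cdot> s \<cdot> h, g \<cdot> s \<cdot> h) \<in> R)"
      using A by (simp add: mem_closure typing)
    then show "covers (Dom C s) (\<lambda>h. (f \<cdot> (s \<cdot> h), g \<cdot> (s \<cdot> h)) \<in> R)"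
      by (rule covers_mono[OF dom_in_Obj[OF s(1)]]) (use A s in \<open>simp add: assoc\<close>)
  qed
  then show "(f, g) \<in> crible_closure C J X Y R" using fg by (simp add: mem_closure)
qed

text \<open>On a common refinement of the two covers, the restrictions of \<open>(f', g')\<close>
  and \<open>(f, g)\<close> coincide and so lie in \<open>R\<close>; closedness returns
  \<open>(f', g')\<close> itself. Hence closed cribles do not distinguish locally equal
  arrows.\<close>

lemma closed_crible_locally_equal:
  assumes R: "closed_crible X Y R" and fg: "(f, g) \<in> R"
    and e: "locally_equal f' f" "locally_equal g' g"
  shows "(f', g') \<in> R"
proof (rule closed_cribleD[OF R])
  note cr = closed_crible_crible[OF R]
  have A: "(f, g) \<in> spans C X Y" using crible_spans[OF cr fg] .
  show "(f', g') \<in> spans C X Y" using A e by (simp add: mem_spans locally_equal_def)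
  have E: "f' \<in> Arr C" "f \<in> Arr C" "Dom C f' = Dom C f" "covers (Dom C f') (\<lambda>s. f' \<cdot> s = f \<cdot> s)"
    "covers (Dom C f') (\<lambda>s. g' \<cdot> s = g \<cdot> s)"
    using A e by (auto simp: mem_spans locally_equal_def)
  have "covers (Dom C f') (\<lambda>s. f' \<cdot> s = f \<cdot> s \<and> g' \<cdot> s = g \<cdot> s)"
  proof (rule covers_conj[OF dom_in_Obj[OF E(1)] E(4,5)])
    fix s h assume "s \<in> Arr C" "Cod C s = Dom C f'" "h \<in> Arr C" "Cod C h = Dom C s" "f' \<cdot> s = f \<cdot> s"
    then show "f' \<cdot> (s \<cdot> h) = f \<cdot> (s \<cdot> h)" using E(1-3) assoc[of h s f'] assoc[of h s f] by simp
  qed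
  then show "covers (Dom C f') (\<lambda>s. (f' \<cdot> s, g' \<cdot> s) \<in> R)"
    by (rule covers_mono[OF dom_in_Obj[OF E(1)]]) (use crible_precomp[OF cr fg] E(3) in simp)
qed

lemma crible_crible_id: "crible C X X (crible_id C X)"
  unfolding crible_def crible_id_def spans_def by (auto simp: typing)

lemma crible_crible_comp:
  assumes R: "crible C X Y R" and S: "crible C Y Z S"
  shows "crible C X Z (crible_comp C S R)"
  unfolding crible_def
proof (intro conjI subsetI ballI impI; clarify)
  fix f g assume "(f, g) \<in> crible_comp C S R"
  then obtain t where t: "(f, t) \<in> S" "(t, g) \<in> R" by (auto simp: crible_comp_def)
  have A: "(f, t) \<in> spans C Y Z" "(t, g) \<in> spans C X Y"
    using crible_spans R S t by blast+
  then show "(f, g) \<in> spans C X Z" by (auto simp: mem_spans)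
  fix h assume h: "h \<in> Arr C" "Cod C h = Dom C f"
  have "(f \<cdot> h, t \<cdot> h) \<in> S" "(t \<cdot> h, g \<cdot> h) \<in> R" "t \<cdot> h \<in> Arr C"
    using crible_precomp[OF S t(1) h] crible_precomp[OF R t(2) h(1)] h A by (auto simp: mem_spans typing)
  then show "(f \<cdot> h, g \<cdot> h) \<in> crible_comp C S R" unfolding crible_comp_def by blast
qed

text \<open>Because closing the diagonal relaxes equality to local equality, the counit of an
  adjunction between closed cribles can only identify arrows locally.\<close>

lemma mem_closure_id:
  "(f, g) \<in> crible_closure C J X X (crible_id C X) \<longleftrightarrow> locally_equal f g \<and> Cod C f = X"
proof
  assume "(f, g) \<in> crible_closure C J X X (crible_id C X)"
  then have A: "f \<in> Arr C" "g \<in> Arr C" "Dom C f = Dom C g" "Cod C f = X" "Cod C g = X"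
    "covers (Dom C f) (\<lambda>s. (f \<cdot> s, g \<cdot> s) \<in> crible_id C X)"
    by (auto simp: mem_closure mem_spans)
  have "covers (Dom C f) (\<lambda>s. f \<cdot> s = g \<cdot> s)"
    using covers_mono[OF dom_in_Obj[OF A(1)] A(6)] by (simp add: crible_id_def)
  then show "locally_equal f g \<and> Cod C f = X" using A by (simp add: locally_equal_def)
next
  assume "locally_equal f g \<and> Cod C f = X"
  then have A: "f \<in> Arr C" "g \<in> Arr C" "Dom C f = Dom C g" "Cod C f = X" "Cod C g = X"
    "covers (Dom C f) (\<lambda>s. f \<cdot> s = g \<cdot> s)"
    by (auto simp: locally_equal_def)
  have "covers (Dom C f) (\<lambda>s. (f \<cdot> s, g \<cdot> s) \<in> crible_id C X)"
    by (rule covers_mono[OF dom_in_Obj[OF A(1)] A(6)]) (use A in \<open>simp add: crible_id_def typing\<close>)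
  then show "(f, g) \<in> crible_closure C J X X (crible_id C X)" using A by (simp add: mem_closure mem_spans)
qed

section \<open>Closed cribles as arrows, and completeness of their homs\<close>

abbreviation (input) "RCJ \<equiv> closed_cribles C J"

lemma closed_cribles_simps:
  "Obj RCJ = Obj C" "Ident RCJ X = (X, crible_closure C J X X (crible_id C X), X)"
  "(Y', S, Z) \<cdot>\<^bsub>RCJ\<^esub> (X, R, Y) = (X, crible_closure C J X Z (crible_comp C S R), Z)"
  "qle RCJ (X, R, Y) (X', S, Y') \<longleftrightarrow> R \<subseteq> S"
  "Dom RCJ (X, R, Y) = X" "Cod RCJ (X, R, Y) = Y"
  "(X, R, Y) \<in> Arr RCJ \<longleftrightarrow> closed_crible X Y R"
  by (simp_all add: closed_cribles_def closed_crible_def)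

lemma closed_cribles_hom: "hom RCJ X Y = {(X, R, Y) | R. closed_crible X Y R}"
  by (auto simp: hom_def closed_cribles_simps)

lemma closed_cribles_hom_Obj: "f \<in> hom RCJ X Y \<Longrightarrow> X \<in> Obj RCJ \<and> Y \<in> Obj RCJ"
  by (auto simp: closed_cribles_hom closed_cribles_simps closed_crible_def)

lemma closed_cribles_ident: "X \<in> Obj RCJ \<Longrightarrow> Ident RCJ X \<in> hom RCJ X X"
  using closure_closed crible_crible_id by (simp add: closed_cribles_hom closed_cribles_simps)

lemma closed_cribles_comp: "\<lbrakk>f \<in> hom RCJ X Y; g \<in> hom RCJ Y Z\<rbrakk> \<Longrightarrow> g \<cdot>\<^bsub>RCJ\<^esub> f \<in> hom RCJ X Z"
  using closure_closed crible_crible_comp by (auto simp: closed_cribles_hom closed_cribles_simps closed_crible_def)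

text \<open>Closedness passes to each member of the family separately. Intersecting with
  \<open>spans C X Y\<close> gives the right value, the top element, for the empty family.\<close>

lemma closed_crible_Inter:
  assumes O: "X \<in> Obj C" "Y \<in> Obj C" and A: "\<And>R. R \<in> A \<Longrightarrow> closed_crible X Y R"
  shows "closed_crible X Y (spans C X Y \<inter> \<Inter>A)"
proof (rule closed_cribleI[OF O])
  show "crible C X Y (spans C X Y \<inter> \<Inter>A)"
    unfolding crible_def
  proof (intro conjI ballI; clarify)
    fix f g h assume fg: "(f, g) \<in> spans C X Y" "(f, g) \<in> \<Inter>A" and h: "h \<in> Arr C" "Cod C h = Dom C f"
    have "(f \<cdot> h, g \<cdot> h) \<in> R" if "R \<in> A" for R
      using crible_precomp[OF closed_crible_crible[OF A[OF that]] _ h] fg that by blast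
    then show "(f \<cdot> h, g \<cdot> h) \<in> spans C X Y \<inter> \<Inter>A" using fg(1) h by (auto simp: mem_spans typing)
  qed
  fix f g assume fg: "(f, g) \<in> spans C X Y"
    and cov: "covers (Dom C f) (\<lambda>s. (f \<cdot> s, g \<cdot> s) \<in> spans C X Y \<inter> \<Inter>A)"
  have O: "Dom C f \<in> Obj C" using fg dom_in_Obj by (simp add: mem_spans)
  have "(f, g) \<in> R" if R: "R \<in> A" for R
    by (rule closed_cribleD[OF A[OF R] fg covers_mono[OF O cov]]) (use R in blast)
  then show "(f, g) \<in> spans C X Y \<inter> \<Inter>A" using fg by blast
qed

lemma closed_cribles_complete:
  assumes O: "X \<in> Obj RCJ" "Y \<in> Obj RCJ"
  shows "complete_lattice (hom_order RCJ X Y)"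
proof -
  let ?L = "hom_order RCJ X Y"
  have O: "X \<in> Obj C" "Y \<in> Obj C" using O by (simp_all add: closed_cribles_simps)
  interpret partial_order ?L
    by unfold_locales (auto simp: hom_order_def closed_cribles_hom closed_cribles_simps)
  have carr: "a \<in> carrier ?L \<longleftrightarrow> (\<exists>R. a = (X, R, Y) \<and> closed_crible X Y R)" for a
    by (auto simp: hom_order_def closed_cribles_hom)
  have le: "a \<sqsubseteq>\<^bsub>?L\<^esub> b \<longleftrightarrow> qle RCJ a b" for a b by (simp add: hom_order_def)
  \<comment> \<open>The criterion asks for a greatest element and for infima of nonempty sets.
    Infima are plain intersections, so no closure has to be computed.\<close>
  show ?thesis
  proof (rule complete_lattice_criterion1)
    have "closed_crible X Y (spans C X Y)" using closed_crible_Inter[OF O, of "{}"] by simp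
    then show "\<exists>g. greatest ?L g (carrier ?L)"
      by (intro exI[of _ "(X, spans C X Y, Y)"])
        (auto simp: greatest_def carr le closed_cribles_simps closed_crible_def crible_def)
  next
    fix A assume A: "A \<subseteq> carrier ?L" "A \<noteq> {}"
    define B where "B = {R. (X, R, Y) \<in> A}"
    have B: "closed_crible X Y R" if "R \<in> B" for R
      using subsetD[OF A(1)] that unfolding B_def carr by blast
    have AB: "a \<in> A \<Longrightarrow> \<exists>R. a = (X, R, Y) \<and> R \<in> B" for a
      using subsetD[OF A(1)] unfolding B_def carr by blast
    have "greatest ?L (X, spans C X Y \<inter> \<Inter>B, Y) (Lower ?L A)"
    proof (rule greatest_LowerI)
      show "(X, spans C X Y \<inter> \<Inter>B, Y) \<in> carrier ?L"
        using closed_crible_Inter[OF O B] by (simp add: carr)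
      fix a assume "a \<in> A"
      then obtain R where "a = (X, R, Y)" "R \<in> B" using AB by blast
      then show "(X, spans C X Y \<inter> \<Inter>B, Y) \<sqsubseteq>\<^bsub>?L\<^esub> a" by (auto simp: le closed_cribles_simps)
    next
      fix b assume b: "b \<in> Lower ?L A"
      obtain R where R: "b = (X, R, Y)" "closed_crible X Y R"
        using b Lower_closed[of ?L A] carr[of b] by blast
      have "R \<subseteq> S" if "S \<in> B" for S
        using Lower_memD[OF b, of "(X, S, Y)"] A(1) that by (simp add: B_def le R closed_cribles_simps)
      moreover have "R \<subseteq> spans C X Y" using R(2) by (auto simp: closed_crible_def crible_def)
      ultimately show "b \<sqsubseteq>\<^bsub>?L\<^esub> (X, spans C X Y \<inter> \<Inter>B, Y)" by (auto simp: le R(1) closed_cribles_simps)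
    qed (fact A(1))
    then show "\<exists>i. greatest ?L i (Lower ?L A)" by blast
  qed
qed

text \<open>Totality of a left adjoint: the unit inequality, applied to the pair
  \<open>(g, g)\<close>, says that \<open>g\<close> is locally related to some
  \<open>t\<close>.\<close>

lemma closed_cribles_adjoint_unit:
  assumes adj: "adjoint_pair RCJ (X, R, Y) (Y, R', X)"
    and g: "g \<in> Arr C" "Cod C g = X"
  shows "covers (Dom C g) (\<lambda>s. \<exists>t. (g \<cdot> s, t) \<in> R' \<and> (t, g \<cdot> s) \<in> R)"
proof -
  have "crible_closure C J X X (crible_id C X) \<subseteq> crible_closure C J X X (crible_comp C R' R)"
    using adj by (simp add: adjoint_pair_def closed_cribles_simps)
  then have "(g, g) \<in> crible_closure C J X X (crible_comp C R' R)"
    using mem_closure_id[of g g X] locally_equal_refl g by blast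
  then have "covers (Dom C g) (\<lambda>s. (g \<cdot> s, g \<cdot> s) \<in> crible_comp C R' R)"
    by (simp add: mem_closure)
  then show ?thesis
    by (rule covers_mono[OF dom_in_Obj[OF g(1)]]) (auto simp: crible_comp_def)
qed

text \<open>Single-valuedness of a left adjoint up to local equality: legs joined through a common
  \<open>t\<close> form a pair in \<open>R\<close> after \<open>R'\<close>, which the counit places
  in the closed diagonal.\<close>

lemma closed_cribles_adjoint_counit:
  assumes R: "closed_crible X Y R" and adj: "adjoint_pair RCJ (X, R, Y) (Y, R', X)"
    and fg: "(f, t) \<in> R" "(t, g) \<in> R'"
  shows "locally_equal f g"
proof -
  have R': "closed_crible Y X R'" using adj by (simp add: adjoint_pair_def closed_cribles_hom closed_cribles_simps)
  have le: "crible_closure C J Y Y (crible_comp C R R') \<subseteq> crible_closure C J Y Y (crible_id C Y)"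
    using adj by (simp add: adjoint_pair_def closed_cribles_simps)
  have "t \<in> Arr C" using crible_spans[OF closed_crible_crible[OF R] fg(1)] by (simp add: mem_spans)
  then have "(f, g) \<in> crible_comp C R R'" using fg by (auto simp: crible_comp_def)
  then have "(f, g) \<in> crible_closure C J Y Y (crible_id C Y)"
    using crible_le_closure[OF crible_crible_comp[OF closed_crible_crible[OF R'] closed_crible_crible[OF R]]] le
    by blast
  then show ?thesis by (simp add: mem_closure_id)
qed

text \<open>If \<open>R \<subseteq> S\<close> are left adjoints and \<open>(f, g) \<in> S\<close>, totality of \<open>R\<close> gives locally a \<open>t\<close> with
  \<open>(t, g) \<in> R \<subseteq> S\<close>, and single-valuedness of \<open>S\<close> identifies \<open>t\<close> with \<open>f\<close>.\<close>

lemma closed_cribles_map_discrete: "map_discrete RCJ"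
  unfolding map_discrete_def
proof (intro allI ballI impI)
  fix X Y a b
  assume a: "a \<in> hom RCJ X Y" "left_adjoint RCJ a" and b: "b \<in> hom RCJ X Y" "left_adjoint RCJ b"
    and le: "qle RCJ a b"
  obtain R S where R: "a = (X, R, Y)" "closed_crible X Y R" and S: "b = (X, S, Y)" "closed_crible X Y S"
    using a(1) b(1) by (auto simp: closed_cribles_hom)
  obtain R' where R': "adjoint_pair RCJ (X, R, Y) (Y, R', X)"
    using a(2) unfolding R(1) left_adjoint_def by (auto simp: adjoint_pair_def closed_cribles_hom closed_cribles_simps(5,6))
  obtain S' where S': "adjoint_pair RCJ (X, S, Y) (Y, S', X)"
    using b(2) unfolding S(1) left_adjoint_def by (auto simp: adjoint_pair_def closed_cribles_hom closed_cribles_simps(5,6))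
  have RS: "R \<subseteq> S" using le by (simp add: R S closed_cribles_simps)
  note cR = closed_crible_crible[OF R(2)] and cS = closed_crible_crible[OF S(2)]
  have "(f, g) \<in> R" if fg: "(f, g) \<in> S" for f g
  proof -
    have sp: "(f, g) \<in> spans C X Y" using crible_spans[OF cS fg] .
    then have A: "f \<in> Arr C" "g \<in> Arr C" "Dom C f = Dom C g" "Cod C f = Y" "Cod C g = X"
      by (auto simp: mem_spans)
    have cov: "covers (Dom C f) (\<lambda>s. \<exists>t. (g \<cdot> s, t) \<in> R' \<and> (t, g \<cdot> s) \<in> R)"
      using closed_cribles_adjoint_unit[OF R' A(2,5)] A(3) by simp
    have "(f \<cdot> s, g \<cdot> s) \<in> R" if s: "s \<in> Arr C" "Cod C s = Dom C f"
      and t: "(t, g \<cdot> s) \<in> R" for s t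
    proof (rule closed_crible_locally_equal[OF R(2) t])
      have fs: "(f \<cdot> s, g \<cdot> s) \<in> S" using crible_precomp[OF cS fg s] .
      have gs: "g \<cdot> s \<in> Arr C" "Cod C (g \<cdot> s) = X" "Dom C (g \<cdot> s) = Dom C s" "f \<cdot> s \<in> Arr C"
        "Dom C (f \<cdot> s) = Dom C s" "Cod C (f \<cdot> s) = Y"
        using A s by (simp_all add: typing)
      have tA: "t \<in> Arr C" "Dom C t = Dom C s" "Cod C t = Y"
        using crible_spans[OF cR t] gs by (auto simp: mem_spans)
      \<comment> \<open>Both \<open>(f s, g s)\<close> and \<open>(t, g s)\<close> lie in
        \<open>S\<close>. A second cover, from totality of \<open>S\<close>, supplies
        \<open>u\<close> with \<open>(g s h, u)\<close> in \<open>S'\<close>; single-valuedness then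
        identifies \<open>f s h\<close> and \<open>t h\<close> with \<open>u\<close>
        locally.\<close>
      have "covers (Dom C s) (\<lambda>h. \<exists>u. (g \<cdot> s \<cdot> h, u) \<in> S' \<and> (u, g \<cdot> s \<cdot> h) \<in> S)"
        using closed_cribles_adjoint_unit[OF S' gs(1,2)] gs(3) by simp
      then have "covers (Dom C s) (\<lambda>h. locally_equal (f \<cdot> s \<cdot> h) (t \<cdot> h))"
      proof (rule covers_mono[OF dom_in_Obj[OF s(1)]])
        fix h assume h: "h \<in> Arr C" "Cod C h = Dom C s"
          and "\<exists>u. (g \<cdot> s \<cdot> h, u) \<in> S' \<and> (u, g \<cdot> s \<cdot> h) \<in> S"
        then obtain u where u: "(g \<cdot> s \<cdot> h, u) \<in> S'" by blast
        have "(f \<cdot> s \<cdot> h, g \<cdot> s \<cdot> h) \<in> S" "(t \<cdot> h, g \<cdot> s \<cdot> h) \<in> S"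
          using crible_precomp[OF cS fs h(1)] crible_precomp[OF cS _ h(1), of t] t RS h(2) gs(5) tA(2) by auto
        then have "locally_equal (f \<cdot> s \<cdot> h) u" "locally_equal (t \<cdot> h) u"
          using closed_cribles_adjoint_counit[OF S(2) S' _ u] by blast+
        then show "locally_equal (f \<cdot> s \<cdot> h) (t \<cdot> h)"
          using locally_equal_trans locally_equal_sym by blast
      qed
      then show "locally_equal (f \<cdot> s) t"
        using locally_equal_local[of "f \<cdot> s" t] gs tA by simp
      show "locally_equal (g \<cdot> s) (g \<cdot> s)" using locally_equal_refl[OF gs(1)] .
    qed
    then have "covers (Dom C f) (\<lambda>s. (f \<cdot> s, g \<cdot> s) \<in> R)"
      by (intro covers_mono[OF dom_in_Obj[OF A(1)] cov]) blast
    then show ?thesis using closed_cribleD[OF R(2) sp] by blast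
  qed
  then show "a = b" using RS R(1) S(1) by auto
qed

text \<open>This is the closure of the crible of all pairs \<open>(g t, t)\<close>, the closed
  crible that represents \<open>g\<close>. Expressing it by local equality makes the converse easy
  to handle.\<close>

definition graph :: "'a \<Rightarrow> ('a \<times> 'a) set" where
  "graph g = {(f, t). t \<in> Arr C \<and> Cod C t = Dom C g \<and> locally_equal f (g \<cdot> t)}"

text \<open>Both parts rest on the same three facts about \<open>graph g\<close>: its pairs are
  spans, it is stable under precomposition, and membership is local. The two legs of a span share
  their domain, so the facts survive swapping the legs.\<close>

lemma closed_graph:
  assumes g: "g \<in> Arr C"
  shows "closed_crible (Dom C g) (Cod C g) (graph g)"
    and "closed_crible (Cod C g) (Dom C g) ((graph g)\<inverse>)"
proof -
  have sp: "(f, t) \<in> spans C (Dom C g) (Cod C g)" if "(f, t) \<in> graph g" for f t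
    using that g by (auto simp: graph_def mem_spans locally_equal_def typing)
  have pre: "(f \<cdot> h, t \<cdot> h) \<in> graph g" if ft: "(f, t) \<in> graph g" and h: "h \<in> Arr C" "Cod C h = Dom C f" for f t h
  proof -
    have t: "t \<in> Arr C" "Cod C t = Dom C g" "locally_equal f (g \<cdot> t)" using ft by (auto simp: graph_def)
    have d: "Dom C f = Dom C t" using sp[OF ft] by (simp add: mem_spans)
    have "locally_equal (f \<cdot> h) (g \<cdot> (t \<cdot> h))"
      using locally_equal_precomp[OF t(3) h] assoc[of h t g] t h d g by simp
    then show ?thesis using t h d by (simp add: graph_def typing)
  qed
  have loc: "(f, t) \<in> graph g"
    if ft: "(f, t) \<in> spans C (Dom C g) (Cod C g)" and cov: "covers (Dom C f) (\<lambda>s. (f \<cdot> s, t \<cdot> s) \<in> graph g)" for f t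
  proof -
    have A: "f \<in> Arr C" "t \<in> Arr C" "Dom C f = Dom C t" "Cod C f = Cod C g" "Cod C t = Dom C g"
      using ft by (auto simp: mem_spans)
    have "covers (Dom C f) (\<lambda>s. locally_equal (f \<cdot> s) (g \<cdot> t \<cdot> s))"
      by (rule covers_mono[OF dom_in_Obj[OF A(1)] cov]) (use A g in \<open>simp add: graph_def assoc\<close>)
    then have "locally_equal f (g \<cdot> t)"
      using locally_equal_local[of f "g \<cdot> t"] A g by (simp add: typing)
    then show ?thesis using A by (simp add: graph_def)
  qed
  note O = dom_in_Obj[OF g] cod_in_Obj[OF g]
  show "closed_crible (Dom C g) (Cod C g) (graph g)"
  proof (rule closed_cribleI[OF O _ loc])
    show "crible C (Dom C g) (Cod C g) (graph g)" using sp pre by (rule cribleI)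
  qed
  show "closed_crible (Cod C g) (Dom C g) ((graph g)\<inverse>)"
  proof (rule closed_cribleI[OF O(2,1)])
    show "crible C (Cod C g) (Dom C g) ((graph g)\<inverse>)"
    proof (rule cribleI; clarify)
      fix t f assume tf: "(f, t) \<in> graph g"
      show sp': "(t, f) \<in> spans C (Cod C g) (Dom C g)" using sp[OF tf] by (simp add: mem_spans)
      fix h assume h: "h \<in> Arr C" "Cod C h = Dom C t"
      show "(f \<cdot> h, t \<cdot> h) \<in> graph g" using pre[OF tf h(1)] h(2) sp' by (simp add: mem_spans)
    qed
    fix t f assume "(t, f) \<in> spans C (Cod C g) (Dom C g)" "covers (Dom C t) (\<lambda>s. (t \<cdot> s, f \<cdot> s) \<in> (graph g)\<inverse>)"
    then show "(t, f) \<in> (graph g)\<inverse>" using loc[of f t] by (simp add: mem_spans)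
  qed
qed

text \<open>For the unit, \<open>(t, t)\<close> factors through the middle arrow \<open>g t\<close>.
  For the counit, two arrows locally equal to the same \<open>g t\<close> are locally equal to each
  other.\<close>

lemma graph_adjoint:
  assumes g: "g \<in> Arr C"
  shows "adjoint_pair RCJ (Dom C g, graph g, Cod C g) (Cod C g, (graph g)\<inverse>, Dom C g)"
proof -
  have "crible_id C (Dom C g) \<subseteq> crible_comp C ((graph g)\<inverse>) (graph g)"
  proof
    fix p assume "p \<in> crible_id C (Dom C g)"
    then obtain t where t: "p = (t, t)" "t \<in> Arr C" "Cod C t = Dom C g" by (auto simp: crible_id_def)
    have "g \<cdot> t \<in> Arr C" using t g by (simp add: typing)
    moreover from this have "(g \<cdot> t, t) \<in> graph g" using t locally_equal_refl by (simp add: graph_def)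
    ultimately show "p \<in> crible_comp C ((graph g)\<inverse>) (graph g)" using t(1) by (auto simp: crible_comp_def)
  qed
  moreover have "crible_closure C J (Cod C g) (Cod C g) (crible_comp C (graph g) ((graph g)\<inverse>))
      \<subseteq> crible_closure C J (Cod C g) (Cod C g) (crible_id C (Cod C g))"
  proof (rule closure_least[OF closure_closed[OF _ _ crible_crible_id]])
    show "crible_comp C (graph g) ((graph g)\<inverse>) \<subseteq> crible_closure C J (Cod C g) (Cod C g) (crible_id C (Cod C g))"
    proof clarify
      fix p q assume "(p, q) \<in> crible_comp C (graph g) ((graph g)\<inverse>)"
      then obtain t where t: "t \<in> Arr C" "Cod C t = Dom C g" "locally_equal p (g \<cdot> t)" "locally_equal q (g \<cdot> t)"
        by (auto simp: crible_comp_def graph_def)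
      have "locally_equal p q" using locally_equal_trans[OF t(3) locally_equal_sym[OF t(4)]] .
      moreover have "Cod C p = Cod C g" using t g by (simp add: locally_equal_def typing)
      ultimately show "(p, q) \<in> crible_closure C J (Cod C g) (Cod C g) (crible_id C (Cod C g))"
        by (simp add: mem_closure_id)
    qed
  qed (use cod_in_Obj[OF g] in auto)
  ultimately show ?thesis
    using closed_graph[OF g] closure_mono by (simp add: adjoint_pair_def closed_cribles_simps closed_cribles_hom)
qed

lemma closed_cribles_weakly_tabular: "weakly_tabular RCJ"
  unfolding weakly_tabular_def
proof (intro allI ballI)
  fix X Y r assume r: "r \<in> hom RCJ X Y"
  obtain R where R: "r = (X, R, Y)" "closed_crible X Y R" using r by (auto simp: closed_cribles_hom)
  note cR = closed_crible_crible[OF R(2)]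
  \<comment> \<open>\<open>k (f, g)\<close> is the graph of \<open>f\<close> after the converse
    graph of \<open>g\<close>. For \<open>(f, g)\<close> in \<open>R\<close> it turns out to be the
    least closed crible containing that pair.\<close>
  define k where "k = (\<lambda>(f, g). crible_closure C J X Y (crible_comp C (graph f) ((graph g)\<inverse>)))"
  define A where "A = (\<lambda>p. (X, k p, Y)) ` R"
  have spR: "f \<in> Arr C" "g \<in> Arr C" "Dom C f = Dom C g" "Cod C f = Y" "Cod C g = X" if "(f, g) \<in> R" for f g
    using crible_spans[OF cR that] by (auto simp: mem_spans)
  have span: "A \<subseteq> map_spans RCJ X Y"
  proof
    fix a assume "a \<in> A"
    then obtain f g where fg: "(f, g) \<in> R" "a = (X, k (f, g), Y)" unfolding A_def by auto
    note s = spR[OF fg(1)]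
    have "a = (Dom C f, graph f, Y) \<cdot>\<^bsub>RCJ\<^esub> (X, (graph g)\<inverse>, Dom C f)"
      by (simp add: fg k_def closed_cribles_simps)
    moreover have "(Dom C f, graph f, Y) \<in> hom RCJ (Dom C f) Y" "(Dom C f, graph g, X) \<in> hom RCJ (Dom C f) X"
      using closed_graph[OF s(1)] closed_graph[OF s(2)] s by (auto simp: closed_cribles_hom)
    moreover have "left_adjoint RCJ (Dom C f, graph f, Y)"
      "adjoint_pair RCJ (Dom C f, graph g, X) (X, (graph g)\<inverse>, Dom C f)"
      using graph_adjoint[OF s(1)] graph_adjoint[OF s(2)] s unfolding left_adjoint_def by auto
    ultimately show "a \<in> map_spans RCJ X Y" unfolding map_spans_def by blast
  qed
  have kc: "closed_crible X Y (k (f, g))" and kR: "k (f, g) \<subseteq> R" and fk: "(f, g) \<in> k (f, g)"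
    if fg: "(f, g) \<in> R" for f g
  proof -
    note s = spR[OF fg]
    have O: "X \<in> Obj C" "Y \<in> Obj C" using R(2) by (auto simp: closed_crible_def)
    have cr: "crible C X Y (crible_comp C (graph f) ((graph g)\<inverse>))"
      using crible_crible_comp[OF closed_crible_crible[OF closed_graph(2)[OF s(2)]], of "Cod C f" "graph f"]
        closed_crible_crible[OF closed_graph(1)[OF s(1)]] s by simp
    show "closed_crible X Y (k (f, g))" using closure_closed[OF O cr] by (simp add: k_def)
    have "crible_comp C (graph f) ((graph g)\<inverse>) \<subseteq> R"
    proof clarify
      fix p q assume "(p, q) \<in> crible_comp C (graph f) ((graph g)\<inverse>)"
      then obtain t where t: "t \<in> Arr C" "Cod C t = Dom C f" "locally_equal p (f \<cdot> t)" "locally_equal q (g \<cdot> t)"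
        by (auto simp: crible_comp_def graph_def)
      show "(p, q) \<in> R"
        using closed_crible_locally_equal[OF R(2) crible_precomp[OF cR fg t(1,2)] t(3,4)] .
    qed
    then show "k (f, g) \<subseteq> R" using closure_least[OF R(2)] by (simp add: k_def)
    \<comment> \<open>The identity of the apex is the middle arrow that puts \<open>(f, g)\<close>
      into its own composite.\<close>
    let ?i = "Ident C (Dom C f)"
    have i: "?i \<in> Arr C" "Cod C ?i = Dom C f" using dom_in_Obj[OF s(1)] by (simp_all add: typing)
    have "f \<cdot> ?i = f" "g \<cdot> ?i = g"
      using comp_ident_right[of f "Dom C f" Y] comp_ident_right[of g "Dom C f" X] s by (auto simp: hom_def)
    then have "(f, ?i) \<in> graph f" "(g, ?i) \<in> graph g"
      using i s locally_equal_refl by (auto simp: graph_def)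
    then have "(f, g) \<in> crible_comp C (graph f) ((graph g)\<inverse>)" using i by (auto simp: crible_comp_def)
    then show "(f, g) \<in> k (f, g)" using crible_le_closure[OF cr] by (auto simp: k_def)
  qed
  have L: "complete_lattice (hom_order RCJ X Y)" using closed_cribles_complete closed_cribles_hom_Obj[OF r] by blast
  have Ah: "A \<subseteq> hom RCJ X Y" using kc by (auto simp: A_def closed_cribles_hom)
  \<comment> \<open>Only the crible underlying the supremum is named; the least upper bound property
    then gives both inclusions between \<open>B\<close> and \<open>R\<close>.\<close>
  obtain B where B: "hom_Sup RCJ X Y A = (X, B, Y)"
    using hom_order_lub(1)[OF L Ah] by (auto simp: closed_cribles_hom)
  have "qle RCJ (hom_Sup RCJ X Y A) r"
  proof (rule hom_order_lub(3)[OF L Ah r])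
    fix a assume "a \<in> A"
    then show "qle RCJ a r" using kR unfolding A_def R(1) by (auto simp: closed_cribles_simps)
  qed
  then have "B \<subseteq> R" unfolding B R(1) by (simp add: closed_cribles_simps)
  moreover have "R \<subseteq> B"
  proof clarify
    fix f g assume fg: "(f, g) \<in> R"
    have "k (f, g) \<subseteq> B"
      using hom_order_lub(2)[OF L Ah, of "(X, k (f, g), Y)"] fg unfolding B by (auto simp: A_def closed_cribles_simps)
    then show "(f, g) \<in> B" using fk[OF fg] by blast
  qed
  ultimately show "\<exists>A\<subseteq>map_spans RCJ X Y. r = hom_Sup RCJ X Y A" using span B R(1) by auto
qed

end

section \<open>Invariance under equivalence\<close>

lemma Sup_functor_mono:
  assumes F: "is_Sup_functor Q R F" and L: "complete_lattice (hom_order Q X Y)"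
    "complete_lattice (hom_order R (ob F X) (ob F Y))"
    and O: "X \<in> Obj Q" "Y \<in> Obj Q" and fg: "f \<in> hom Q X Y" "g \<in> hom Q X Y" "qle Q f g"
  shows "qle R (ar F f) (ar F g)"
proof -
  have F1: "ar F h \<in> hom R (ob F X) (ob F Y)" if "h \<in> hom Q X Y" for h
    using F that by (auto simp: is_Sup_functor_def is_functor_def hom_def)
  have "ar F (hom_Sup Q X Y {f, g}) = hom_Sup R (ob F X) (ob F Y) (ar F ` {f, g})"
    using F O fg(1,2) unfolding is_Sup_functor_def by (metis empty_subsetI insert_subset)
  then have "ar F g = hom_Sup R (ob F X) (ob F Y) {ar F f, ar F g}"
    using hom_Sup_pair[OF L(1) fg] by simp
  then show ?thesis
    using hom_order_lub(2)[OF L(2), of "{ar F f, ar F g}" "ar F f"] F1 fg by auto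
qed

text \<open>A monotone functor preserves the unit and counit inequalities. Completeness and typing
  are explicit hypotheses so that the lemma applies to both functors of the equivalence.\<close>

lemma Sup_functor_adjoint_pair:
  assumes F: "is_Sup_functor Q R F"
    and QL: "\<And>X Y. \<lbrakk>X \<in> Obj Q; Y \<in> Obj Q\<rbrakk> \<Longrightarrow> complete_lattice (hom_order Q X Y)"
    and RL: "\<And>X Y. \<lbrakk>X \<in> Obj R; Y \<in> Obj R\<rbrakk> \<Longrightarrow> complete_lattice (hom_order R X Y)"
    and O: "X \<in> Obj Q" "Y \<in> Obj Q" and f: "f \<in> hom Q X Y" "adjoint_pair Q f f'"
    and typed: "Ident Q X \<in> hom Q X X" "Ident Q Y \<in> hom Q Y Y"
      "f' \<cdot>\<^bsub>Q\<^esub> f \<in> hom Q X X" "f \<cdot>\<^bsub>Q\<^esub> f' \<in> hom Q Y Y"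
  shows "adjoint_pair R (ar F f) (ar F f')"
proof -
  have F1: "ar F h \<in> hom R (ob F U) (ob F V)" if "h \<in> hom Q U V" for h U V
    using F that by (auto simp: is_Sup_functor_def is_functor_def hom_def)
  have Fo: "ob F U \<in> Obj R" if "U \<in> Obj Q" for U
    using F that by (auto simp: is_Sup_functor_def is_functor_def)
  have f': "f' \<in> hom Q Y X" "qle Q (Ident Q X) (f' \<cdot>\<^bsub>Q\<^esub> f)" "qle Q (f \<cdot>\<^bsub>Q\<^esub> f') (Ident Q Y)"
    using f by (auto simp: adjoint_pair_def hom_def)
  have eqs: "ar F (Ident Q X) = Ident R (ob F X)" "ar F (Ident Q Y) = Ident R (ob F Y)"
    "ar F (f' \<cdot>\<^bsub>Q\<^esub> f) = ar F f' \<cdot>\<^bsub>R\<^esub> ar F f" "ar F (f \<cdot>\<^bsub>Q\<^esub> f') = ar F f \<cdot>\<^bsub>R\<^esub> ar F f'"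
    using F O f(1) f'(1) by (auto simp: is_Sup_functor_def is_functor_def hom_def)
  have "qle R (Ident R (ob F X)) (ar F f' \<cdot>\<^bsub>R\<^esub> ar F f)"
    using Sup_functor_mono[OF F QL RL O(1,1) typed(1,3) f'(2)] O Fo eqs by simp
  moreover have "qle R (ar F f \<cdot>\<^bsub>R\<^esub> ar F f') (Ident R (ob F Y))"
    using Sup_functor_mono[OF F QL RL O(2,2) typed(4,2) f'(3)] O Fo eqs by simp
  ultimately show ?thesis
    using F1[OF f(1)] F1[OF f'(1)] by (auto simp: adjoint_pair_def hom_def)
qed

lemma natural_isoD:
  assumes n: "natural_iso Q Q (comp_func G F) id_func \<eta>" and r: "r \<in> hom Q X Y"
    and O: "X \<in> Obj Q" "Y \<in> Obj Q"
  shows "\<eta> X \<in> hom Q (ob G (ob F X)) X" "iso Q (\<eta> X)"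
    "\<eta> Y \<cdot>\<^bsub>Q\<^esub> ar G (ar F r) = r \<cdot>\<^bsub>Q\<^esub> \<eta> X"
  using n r O by (auto simp: natural_iso_def comp_func_def id_func_def hom_def)

section \<open>Transfer of the two properties along an equivalence\<close>

context quantaloid
begin

lemma iso_inverse:
  assumes "iso Q e" "e \<in> hom Q X Y"
  obtains e' where "e' \<in> hom Q Y X" "e' \<cdot> e = Ident Q X" "e \<cdot> e' = Ident Q Y"
  using assms by (auto simp: iso_def hom_def)

text \<open>Unit and counit are equalities. This makes the components of the natural isomorphism
  left adjoints.\<close>

lemma inverse_adjoint:
  assumes "e \<in> hom Q X Y" "e' \<in> hom Q Y X" "e' \<cdot> e = Ident Q X" "e \<cdot> e' = Ident Q Y"
  shows "adjoint_pair Q e e'"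
  using adjoint_pairI[OF assms(1,2)] assms(3,4) hom_Obj[OF assms(1)] qle_refl[OF ident_in_hom] by simp

text \<open>\<open>F\<close> preserves order and left adjoints, so discreteness of \<open>R\<close>
  gives \<open>ar F f = ar F g\<close>. Naturality makes \<open>F\<close> faithful: an arrow
  \<open>h\<close> is recovered from \<open>ar F h\<close> as \<open>\<eta> Y\<close> after
  \<open>ar G (ar F h)\<close> after the inverse of \<open>\<eta> X\<close>.\<close>

lemma map_discrete_transfer:
  fixes R :: "('p, 'b, 'n) quant_scheme"
  assumes F: "is_Sup_functor Q R F" and G: "is_Sup_functor R Q G"
    and n: "natural_iso Q Q (comp_func G F) id_func \<eta>"
    and RL: "\<And>X Y. \<lbrakk>X \<in> Obj R; Y \<in> Obj R\<rbrakk> \<Longrightarrow> complete_lattice (hom_order R X Y)"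
    and md: "map_discrete R"
  shows "map_discrete Q"
  unfolding map_discrete_def
proof (intro allI ballI impI)
  fix X Y f g
  assume f: "f \<in> hom Q X Y" "left_adjoint Q f" and g: "g \<in> hom Q X Y" "left_adjoint Q g" and le: "qle Q f g"
  note O = hom_Obj[OF f(1), THEN conjunct1] hom_Obj[OF f(1), THEN conjunct2]
  have FF: "is_functor Q R F" "is_functor R Q G" using F G by (auto simp: is_Sup_functor_def)
  have Fo: "ob F U \<in> Obj R" if "U \<in> Obj Q" for U
    using FF that by (auto simp: is_functor_def)
  have Fh: "ar F h \<in> hom R (ob F X) (ob F Y)" if "h \<in> hom Q X Y" for h
    using FF that by (auto simp: is_functor_def hom_def)
  have Fl: "left_adjoint R (ar F h)" if h: "h \<in> hom Q X Y" "left_adjoint Q h" for h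
  proof -
    obtain h' where h': "adjoint_pair Q h h'" using h(2) by (auto simp: left_adjoint_def)
    note D = adjoint_pairD(1)[OF h' h(1)]
    show ?thesis
      using Sup_functor_adjoint_pair[OF F complete RL O h(1) h' ident_in_hom ident_in_hom
          comp_in_hom[OF h(1) D] comp_in_hom[OF D h(1)]] O unfolding left_adjoint_def by blast
  qed
  have "qle R (ar F f) (ar F g)"
    using Sup_functor_mono[OF F complete RL O f(1) g(1) le] O Fo by simp
  then have e: "ar F f = ar F g"
    using md Fh Fl f g unfolding map_discrete_def by blast
  note nf = natural_isoD[OF n f(1) O] and ng = natural_isoD[OF n g(1) O]
  obtain e' where e': "e' \<in> hom Q X (ob G (ob F X))" "\<eta> X \<cdot> e' = Ident Q X"
    using iso_inverse[OF nf(2,1)] by blast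
  have "h = (h \<cdot> \<eta> X) \<cdot> e'" if "h \<in> hom Q X Y" for h
    using comp_assoc[OF e'(1) nf(1) that] e'(2) comp_ident_right[OF that] by simp
  then show "f = g" using nf(3) ng(3) e f(1) g(1) by metis
qed

text \<open>\<open>ar F r\<close> is decomposed in \<open>R\<close>, the decomposition is mapped
  back by \<open>G\<close>, and conjugation with \<open>\<eta>\<close> turns it into one of
  \<open>r\<close>. The assumptions on \<open>R\<close> list the typing and completeness facts used,
  so that \<open>R\<close> can be supplied as a bare structure.\<close>

lemma weakly_tabular_transfer:
  fixes R :: "('p, 'b, 'n) quant_scheme"
  assumes F: "is_Sup_functor Q R F" and G: "is_Sup_functor R Q G"
    and n: "natural_iso Q Q (comp_func G F) id_func \<eta>"
    and RL: "\<And>X Y. \<lbrakk>X \<in> Obj R; Y \<in> Obj R\<rbrakk> \<Longrightarrow> complete_lattice (hom_order R X Y)"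
    and Ro: "\<And>X Y f. f \<in> hom R X Y \<Longrightarrow> X \<in> Obj R \<and> Y \<in> Obj R"
    and Ri: "\<And>X. X \<in> Obj R \<Longrightarrow> Ident R X \<in> hom R X X"
    and Rc: "\<And>X Y Z f g. \<lbrakk>f \<in> hom R X Y; g \<in> hom R Y Z\<rbrakk> \<Longrightarrow> g \<cdot>\<^bsub>R\<^esub> f \<in> hom R X Z"
    and wt: "weakly_tabular R"
  shows "weakly_tabular Q"
  unfolding weakly_tabular_def
proof (intro allI ballI)
  fix X Y r assume r: "r \<in> hom Q X Y"
  note O = hom_Obj[OF r, THEN conjunct1] hom_Obj[OF r, THEN conjunct2]
  have FF: "is_functor Q R F" "is_functor R Q G" using F G by (auto simp: is_Sup_functor_def)
  have Fo: "ob F U \<in> Obj R" if "U \<in> Obj Q" for U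
    using FF that by (auto simp: is_functor_def)
  have Go: "ob G U \<in> Obj Q" if "U \<in> Obj R" for U
    using FF that by (auto simp: is_functor_def)
  have Fh: "ar F h \<in> hom R (ob F U) (ob F V)" if "h \<in> hom Q U V" for h U V
    using FF that by (auto simp: is_functor_def hom_def)
  have Gh: "ar G h \<in> hom Q (ob G U) (ob G V)" if "h \<in> hom R U V" for h U V
    using FF that by (auto simp: is_functor_def hom_def)
  have Gadj: "adjoint_pair Q (ar G h) (ar G h')" if h: "h \<in> hom R U V" "adjoint_pair R h h'" for h h' U V
  proof -
    have D: "h' \<in> hom R V U" using h by (auto simp: adjoint_pair_def hom_def)
    have U: "U \<in> Obj R" "V \<in> Obj R" using Ro[OF h(1)] by auto
    show ?thesis
      using Sup_functor_adjoint_pair[OF G RL complete U h Ri[OF U(1)] Ri[OF U(2)] Rc[OF h(1) D] Rc[OF D h(1)]]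
      by blast
  qed
  note nX = natural_isoD[OF n r O]
  have nY: "\<eta> Y \<in> hom Q (ob G (ob F Y)) Y" "iso Q (\<eta> Y)"
    using natural_isoD[OF n ident_in_hom[OF O(2)] O(2,2)] by blast+
  let ?X = "ob G (ob F X)" and ?Y = "ob G (ob F Y)"
  obtain e where e: "e \<in> hom Q X ?X" "e \<cdot> \<eta> X = Ident Q ?X" "\<eta> X \<cdot> e = Ident Q X"
    using iso_inverse[OF nX(2,1)] by blast
  obtain d where d: "d \<in> hom Q Y ?Y" "d \<cdot> \<eta> Y = Ident Q ?Y" "\<eta> Y \<cdot> d = Ident Q Y"
    using iso_inverse[OF nY(2,1)] by blast
  have adjX: "adjoint_pair Q (\<eta> X) e" using inverse_adjoint[OF nX(1) e] .
  have adjY: "adjoint_pair Q (\<eta> Y) d" using inverse_adjoint[OF nY(1) d] .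
  obtain A where A: "A \<subseteq> map_spans R (ob F X) (ob F Y)" "ar F r = hom_Sup R (ob F X) (ob F Y) A"
    using wt Fh[OF r] unfolding weakly_tabular_def by blast
  have Rspan: "map_spans R U V \<subseteq> hom R U V" for U V
  proof
    fix a assume "a \<in> map_spans R U V"
    then obtain W f g g' where a: "a = f \<cdot>\<^bsub>R\<^esub> g'" "f \<in> hom R W V" "g \<in> hom R W U" "adjoint_pair R g g'"
      unfolding map_spans_def by blast
    have "g' \<in> hom R U W" using a(3,4) by (auto simp: adjoint_pair_def hom_def)
    then show "a \<in> hom R U V" unfolding a(1) using a(2) by (rule Rc)
  qed
  have Ah: "A \<subseteq> hom R (ob F X) (ob F Y)" using A(1) Rspan by blast
  have GA: "ar G ` A \<subseteq> hom Q ?X ?Y" using Ah Gh by blast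
  have Ge: "ar G (ar F r) = hom_Sup Q ?X ?Y (ar G ` A)"
    using G A(2) Fo[OF O(1)] Fo[OF O(2)] Ah by (auto simp: is_Sup_functor_def)
  have Or: "?X \<in> Obj Q" "?Y \<in> Obj Q" using O Fo Go by blast+
  define B where "B = (\<lambda>f. (\<eta> Y \<cdot> f) \<cdot> e) ` (ar G ` A)"
  have "r = (\<eta> Y \<cdot> ar G (ar F r)) \<cdot> e"
    using comp_assoc[OF e(1) nX(1) r] e(3) comp_ident_right[OF r] nX(3) by simp
  also have "\<dots> = hom_Sup Q ?X Y ((\<lambda>f. \<eta> Y \<cdot> f) ` (ar G ` A)) \<cdot> e"
    unfolding Ge using comp_Sup_right[OF Or(1) GA nY(1)] by simp
  also have "\<dots> = hom_Sup Q X Y ((\<lambda>f. f \<cdot> e) ` ((\<lambda>f. \<eta> Y \<cdot> f) ` (ar G ` A)))"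
    using comp_Sup_left[OF O(2) e(1), of "(\<lambda>f. \<eta> Y \<cdot> f) ` (ar G ` A)"] comp_in_hom[OF _ nY(1)] GA by blast
  finally have "r = hom_Sup Q X Y B" by (simp add: B_def image_image)
  moreover have "B \<subseteq> map_spans Q X Y"
  proof
    fix b assume "b \<in> B"
    then obtain a where a: "a \<in> A" "b = (\<eta> Y \<cdot> ar G a) \<cdot> e" unfolding B_def by blast
    then obtain W f g g' where fg: "a = f \<cdot>\<^bsub>R\<^esub> g'" "f \<in> hom R W (ob F Y)" "left_adjoint R f"
      "g \<in> hom R W (ob F X)" "adjoint_pair R g g'"
      using A(1) unfolding map_spans_def by blast
    obtain f' where f': "adjoint_pair R f f'" using fg(3) by (auto simp: left_adjoint_def)
    have g': "g' \<in> hom R (ob F X) W" using fg(4,5) by (auto simp: adjoint_pair_def hom_def)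
    have Ga: "ar G a = ar G f \<cdot> ar G g'"
      using FF(2) fg(2) g' unfolding fg(1) by (auto simp: is_functor_def hom_def)
    \<comment> \<open>After regrouping, the left factor is a map into \<open>Y\<close>, and the
      right factor is the right adjoint of the map \<open>\<eta> X\<close> after
      \<open>ar G g\<close>.\<close>
    have "b = (\<eta> Y \<cdot> ar G f) \<cdot> (ar G g' \<cdot> e)"
      unfolding a(2) Ga using Gh[OF fg(2)] Gh[OF g'] nY(1) e(1) by (simp add: typing assoc)
    moreover have "\<eta> Y \<cdot> ar G f \<in> hom Q (ob G W) Y" using comp_in_hom[OF Gh[OF fg(2)] nY(1)] .
    moreover have "left_adjoint Q (\<eta> Y \<cdot> ar G f)"
      using adjoint_comp[OF Gadj[OF fg(2) f'] Gh[OF fg(2)] adjY nY(1)] unfolding left_adjoint_def by blast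
    moreover have "\<eta> X \<cdot> ar G g \<in> hom Q (ob G W) X" using comp_in_hom[OF Gh[OF fg(4)] nX(1)] .
    moreover have "adjoint_pair Q (\<eta> X \<cdot> ar G g) (ar G g' \<cdot> e)"
      using adjoint_comp[OF Gadj[OF fg(4,5)] Gh[OF fg(4)] adjX nX(1)] .
    ultimately show "b \<in> map_spans Q X Y" unfolding map_spans_def by blast
  qed
  ultimately show "\<exists>A\<subseteq>map_spans Q X Y. r = hom_Sup Q X Y A" by blast
qed

end

theorem proposition4p4:
  fixes Q :: "('o, 'a, 'm) quant_scheme"
    and C :: "('p, 'b, 'n) cat_scheme"
    and J :: "'p \<Rightarrow> 'b set set"
  assumes "quantaloid Q"
    and "site C J"
    and "quantaloid_equivalent Q (closed_cribles C J)"
  shows "subcanonical (MapCat Q) (map_topology Q)"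
proof -
  interpret quantaloid Q by fact
  interpret S: site C J by fact
  obtain F G \<eta> where F: "is_Sup_functor Q (closed_cribles C J) F"
    and G: "is_Sup_functor (closed_cribles C J) Q G"
    and n: "natural_iso Q Q (comp_func G F) id_func \<eta>"
    using assms(3) unfolding quantaloid_equivalent_def naturally_isomorphic_def by blast
  show ?thesis
  proof (rule subcanonical_map_topology)
    show "map_discrete Q"
      by (rule map_discrete_transfer[OF F G n S.closed_cribles_complete S.closed_cribles_map_discrete])
    show "weakly_tabular Q"
      by (rule weakly_tabular_transfer[OF F G n S.closed_cribles_complete S.closed_cribles_hom_Obj S.closed_cribles_ident S.closed_cribles_comp
            S.closed_cribles_weakly_tabular])
  qed
qed

end
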